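(* Let $C(x)=C_i(x,\xi)$ with $i=1$ or $i=2$ be one of the boundary curves defined in the context, where $\xi=b/n^{1/2}>0$ is held fixed as $n\to\infty$, let $\beta\in(0,1)$, and let $k_0$ be an integer with $1\le k_0<\beta n$. Then under the overall null hypothesis, that the $n$ $p$-values are independent and uniformly distributed on $[0,1]$, with order statistics $p_{(1)}\le\cdots\le p_{(n)}$, as $n\to\infty$, $$\mathbb{P}\Big(\bigcup_{k=k_0}^{\beta n}\{p_{(k)}\le C(k/n)\}\Big)=(1+o(1))\sum_{k=k_0}^{\beta n}\Big\{1-\frac{(n-k+1)\,C'(k/n)}{n[1-C(k/n)]}\Big\}\,\mathbb{P}_{\mathrm{Bin}}\big(n,k,C(k/n)\big).$$
   Context: Put $f_1(x,y)=\dfrac{x-y}{[y(1-y)]^{1/2}}$ and $f_2(x,y)=2\big[x\log\frac{x}{y}-(x-y)\big]$. For $x\in(0,1)$, $\xi>0$ and $i\in\{1,2\}$, $C_i(x,\xi)$ denotes the root $y\in(0,x)$ of $f_i(x,y)=\xi^i$. The curve $C_1$ corresponds to the higher criticism statistic and $C_2$ to the modified Berk--Jones statistic, at threshold $b=\xi n^{1/2}$. $C'(x)=\partial C(x,\xi)/\partial x$ is the derivative in the first argument. $\mathbb{P}_{\mathrm{Bin}}(n,k,p)=\binom{n}{k}p^k(1-p)^{n-k}$ is the binomial probability. When $\beta n$ is not an integer, the upper limit $\beta n$ may be read as $\lfloor\beta n\rfloor$ or $\lceil\beta n\rceil$. *)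

theory Defs
  imports "HOL-Probability.Probability" "HOL-Library.Landau_Symbols"
begin

definition f1 :: "real \<Rightarrow> real \<Rightarrow> real" where
  "f1 x y = (x - y) / sqrt (y * (1 - y))"

definition f2 :: "real \<Rightarrow> real \<Rightarrow> real" where
  "f2 x y = 2 * (x * ln (x / y) - (x - y))"

definition gof :: "nat \<Rightarrow> real \<Rightarrow> real \<Rightarrow> real" where
  "gof i = (if i = 1 then f1 else f2)"

text \<open>Meaningful for \<open>i \<in> {1, 2}\<close>, \<open>0 < x < 1\<close> and \<open>\<xi> > 0\<close>, where the root exists and is
  unique: see \<open>boundary_ex1\<close> below.\<close>

definition boundary :: "nat \<Rightarrow> real \<Rightarrow> real \<Rightarrow> real" where
  "boundary i x \<xi> = (THE y. 0 < y \<and> y < x \<and> gof i x y = \<xi> ^ i)"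

text \<open>The \<open>k\<close>-th smallest of \<open>v 0, \<dots>, v (n - 1)\<close>, for \<open>1 \<le> k \<le> n\<close>.\<close>

definition order_stat :: "nat \<Rightarrow> (nat \<Rightarrow> real) \<Rightarrow> nat \<Rightarrow> real" where
  "order_stat n v k = sort (map v [0..<n]) ! (k - 1)"

definition binom_prob :: "nat \<Rightarrow> nat \<Rightarrow> real \<Rightarrow> real" where
  "binom_prob n k p = real (n choose k) * p ^ k * (1 - p) ^ (n - k)"

lemma f1_strict_antimono:
  assumes "0 < y" "y < z" "z \<le> x" "x < 1"
  shows "f1 x z < f1 x y"
proof -
  have *: "f1 x w = (x - w) / sqrt (1 - w) / sqrt w" for w
    by (simp add: f1_def real_sqrt_mult)
  have d: "(x - w) / sqrt (1 - w) = sqrt (1 - w) - (1 - x) / sqrt (1 - w)" if "w < 1" for w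
    using that by (simp add: field_simps flip: power2_eq_square)
  have "(1 - x) / sqrt (1 - y) \<le> (1 - x) / sqrt (1 - z)"
    using assms by (intro divide_left_mono) auto
  moreover have "sqrt (1 - z) < sqrt (1 - y)"
    using assms by simp
  ultimately have "(x - z) / sqrt (1 - z) < (x - y) / sqrt (1 - y)"
    using d[of y] d[of z] assms by linarith
  then have "(x - z) / sqrt (1 - z) / sqrt z < (x - y) / sqrt (1 - y) / sqrt z"
    using assms by (intro divide_strict_right_mono) auto
  also have "\<dots> \<le> (x - y) / sqrt (1 - y) / sqrt y"
    using assms by (intro divide_left_mono) auto
  finally show ?thesis by (simp add: *)
qed

lemma f2_strict_antimono:
  assumes "0 < y" "y < z" "z \<le> x"
  shows "f2 x z < f2 x y"
proof -
  have "ln (y / z) \<le> y / z - 1" "y / z \<noteq> 1"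
    using assms by (auto intro!: ln_le_minus_one)
  then have "ln (y / z) < y / z - 1"
    using assms ln_eq_minus_one[of "y / z"] by fastforce
  then have "z * ln (y / z) < z * (y / z - 1)"
    using assms by (intro mult_strict_left_mono) auto
  also have "z * (y / z - 1) = y - z"
    using assms by (simp add: field_simps)
  finally have "z * ln (z / y) > z - y"
    using assms by (simp add: ln_div algebra_simps)
  moreover have "z * ln (z / y) \<le> x * ln (z / y)"
    using assms by (intro mult_right_mono) auto
  ultimately have "x * ln (z / y) > z - y"
    by linarith
  then show ?thesis
    using assms by (simp add: f2_def ln_div algebra_simps)
qed

lemma boundary_ex1:
  assumes "i \<in> {1, 2}" "0 < x" "x < 1" "0 < \<xi>"
  shows "\<exists>!y. 0 < y \<and> y < x \<and> gof i x y = \<xi> ^ i"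
proof -
  have anti: "gof i x z < gof i x y" if "0 < y" "y < z" "z \<le> x" for y z
    using f1_strict_antimono f2_strict_antimono that assms by (auto simp: gof_def)
  have "filterlim (gof i x) at_top (at_right 0)"
    using assms unfolding gof_def f1_def f2_def by (auto; real_asymp)
  then have "\<forall>\<^sub>F y in at_right 0. \<xi> ^ i \<le> gof i x y"
    by (simp add: filterlim_at_top)
  moreover have "\<forall>\<^sub>F y in at_right 0. 0 < y \<and> y < x"
    using assms by (intro eventually_at_rightI[of 0 x]) auto
  ultimately have "\<forall>\<^sub>F y in at_right (0::real). 0 < y \<and> y < x \<and> \<xi> ^ i \<le> gof i x y"
    by eventually_elim auto
  then obtain a where a: "0 < a" "a < x" "\<xi> ^ i \<le> gof i x a"
    using eventually_happens[of _ "at_right (0::real)"] trivial_limit_at_right_real by blast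
  have pos: "\<xi> ^ i > 0" using assms by simp
  have gx: "gof i x x = 0" using assms by (auto simp: gof_def f1_def f2_def)
  have "continuous_on {a..x} (gof i x)"
    using a assms unfolding gof_def f1_def f2_def
    by (auto intro!: continuous_intros)
  then obtain y where y: "a \<le> y" "y \<le> x" "gof i x y = \<xi> ^ i"
    using IVT2'[of "gof i x" x "\<xi> ^ i" a] a gx pos by force
  then have "y \<noteq> x" using gx pos by (metis less_irrefl)
  then have "0 < y \<and> y < x \<and> gof i x y = \<xi> ^ i" using y a by auto
  then show ?thesis
  proof (rule ex1I)
    fix z assume "0 < z \<and> z < x \<and> gof i x z = \<xi> ^ i"
    then show "z = y"
      using anti[of y z] anti[of z y] y a by (cases z y rule: linorder_cases) auto
  qed
qed

end

theory Submission
  imports Defs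
begin

text \<open>
  Since \<open>\<xi>\<close> stays fixed while \<open>n\<close> grows, this is a large-deviation regime, and both boundary curves
  are flat at the origin: \<open>C'(x)\<close> and \<open>C(x)/x\<close> tend to \<open>0\<close> as \<open>x \<rightarrow> 0\<close>. The \<open>k\<close>-th order statistic
  is at most \<open>C(k/n)\<close> iff at least \<open>k\<close> sample points lie below \<open>C(k/n)\<close>. Both sides of the claim turn
  out to be asymptotic to the plain sum \<open>S\<close> of the binomial probabilities \<open>b\<^sub>k\<close> that exactly \<open>k\<close>
  points lie below \<open>C(k/n)\<close>. In particular the factor in braces in the formula tends to \<open>1\<close> on all
  terms that matter.

  Fix a small \<open>\<epsilon>\<close>. The indices \<open>k > \<epsilon>n\<close> are negligible. Splitting the relative entropy of
  \<open>Bernoulli x\<close> with respect to \<open>Bernoulli (C(x))\<close> as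
  \<open>[x log (x/C(x)) - (x - C(x))] + [(1 - x) log ((1 - x)/(1 - C(x))) + (x - C(x))]\<close>,
  the first bracket is at least a constant \<open>\<rho>\<close> (namely \<open>0\<close> for higher criticism and exactly \<open>\<xi>\<^sup>2/2\<close> for
  Berk-Jones), and the second one is positive, hence at least some \<open>\<kappa> > 0\<close> on
  a compact interval inside \<open>(0, 1)\<close>. So
  these \<open>b\<^sub>k\<close> are at most \<open>exp (-n(\<rho> + \<kappa>))\<close>. The single term with \<open>k = k0\<close> decays only with
  exponential rate \<open>\<rho>\<close>, because \<open>x log (1/C(x)) \<rightarrow> \<rho>\<close> as \<open>x \<rightarrow> 0\<close>. This comparison is
  \<open>macroscopic_hits_negligible\<close>.

  For \<open>k \<le> \<epsilon>n\<close> let \<open>\<delta>\<close> bound \<open>C'\<close> on \<open>(0, \<epsilon>]\<close>. The mean \<open>nC(k/n)\<close> is at most \<open>\<delta>k\<close>, so the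
  binomial tail beyond \<open>k\<close> is a geometric series dominated by \<open>b\<^sub>k\<close>. The union bound then gives the
  upper estimate. For the lower estimate, the union contains the following events, which are
  disjoint for different \<open>k\<close>: exactly \<open>k\<close> points lie below the \<open>k\<close>-th level, and no later level with
  index up to \<open>\<epsilon>n\<close> is hit. Given exactly \<open>k\<close> points below the \<open>k\<close>-th level, hitting the level with
  index \<open>k + m\<close> needs \<open>m\<close> of the other points in an interval of length at most \<open>\<delta>m/n\<close>, which has
  conditional probability at most \<open>(6\<delta>)^m\<close>. Summing over \<open>m\<close> loses only a factor \<open>1 - O(\<delta>)\<close>; this is
  \<open>prob_hit_ge\<close>. Finally \<open>\<delta>\<close> is arbitrary.

  The locale \<open>flat_boundary\<close> collects what the argument uses about \<open>C\<close>. Both curves satisfy it because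
  they can be written with the inverse of an explicit function: \<open>C\<^sub>1\<close> inverts
  \<open>y \<mapsto> y + \<xi> (y(1 - y))\<^sup>1\<^sup>/\<^sup>2\<close>, and \<open>x/C\<^sub>2(x)\<close> inverts \<open>r \<mapsto> \<xi>\<^sup>2 / (2 (log r - 1 + 1/r))\<close>.
\<close>

section \<open>Order statistics and counts of a uniform sample\<close>

lemma sorted_nth_le_iff:
  fixes c :: "'a::linorder"
  assumes "sorted ys" "k < length ys"
  shows "ys ! k \<le> c \<longleftrightarrow> k < length (filter (\<lambda>x. x \<le> c) ys)"
  using assms
proof (induction ys arbitrary: k)
  case (Cons y ys)
  show ?case
  proof (cases "y \<le> c")
    case True
    then show ?thesis using Cons by (cases k) auto
  next
    case False
    then have *: "filter (\<lambda>x. x \<le> c) (y # ys) = []"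
      using Cons.prems by (auto simp: filter_empty_conv)
    have "y \<le> (y # ys) ! k"
      using Cons.prems by (cases k) auto
    then have "\<not> (y # ys) ! k \<le> c"
      using False by auto
    then show ?thesis unfolding * by simp
  qed
qed simp

text \<open>This turns events about order statistics into events about the counting process, whose law is
  binomial.\<close>
lemma order_stat_le_iff:
  assumes "1 \<le> k" "k \<le> n"
  shows "order_stat n v k \<le> c \<longleftrightarrow> k \<le> card {j \<in> {..<n}. v j \<le> c}"
proof -
  have "length (filter (\<lambda>x. x \<le> c) (sort (map v [0..<n]))) = length (filter (\<lambda>x. x \<le> c) (map v [0..<n]))"
    by (simp add: filter_sort)
  also have "\<dots> = length (filter (\<lambda>j. v j \<le> c) [0..<n])"
    by (simp add: filter_map o_def)
  also have "\<dots> = card {j \<in> {..<n}. v j \<le> c}"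
    by (subst distinct_card[symmetric]) (auto intro!: arg_cong[where f = card])
  finally show ?thesis
    using sorted_nth_le_iff[of "sort (map v [0..<n])" "k - 1" c] assms
    by (auto simp: order_stat_def)
qed

locale uniform_sample = prob_space M for M :: "'a measure" +
  fixes n :: nat and X :: "nat \<Rightarrow> 'a \<Rightarrow> real"
  assumes indep_X: "indep_vars (\<lambda>_. borel) X {..<n}"
    and uniform_X: "j < n \<Longrightarrow> distr M borel (X j) = uniform_measure lborel {0..1}"
begin

definition below :: "real \<Rightarrow> 'a \<Rightarrow> nat set" where
  "below t \<omega> = {j \<in> {..<n}. X j \<omega> \<le> t}"

lemma below_subset: "below t \<omega> \<subseteq> {..<n}"
  by (auto simp: below_def)

lemma finite_below [simp]: "finite (below t \<omega>)"
  using finite_subset[OF below_subset] by blast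

lemma measurable_X: "j < n \<Longrightarrow> X j \<in> borel_measurable M"
  using indep_X by (auto simp: indep_vars_def)

lemma box_in_events:
  assumes "\<And>j. j < n \<Longrightarrow> B j \<in> sets borel"
  shows "{\<omega> \<in> space M. \<forall>j<n. X j \<omega> \<in> B j} \<in> events"
proof -
  have "{\<omega> \<in> space M. X j \<omega> \<in> B j} \<in> events" if "j \<in> {..<n}" for j
    by (rule measurable_sets_Collect[OF measurable_X]) (use that assms in auto)
  then have "{\<omega> \<in> space M. \<forall>j\<in>{..<n}. X j \<omega> \<in> B j} \<in> events"
    by (rule sets.sets_Collect_finite_All[OF _ finite_lessThan])
  then show ?thesis
    unfolding Ball_def lessThan_iff .
qed

lemma prob_coordinate:
  assumes "j < n" "B \<in> sets borel"
  shows "prob {\<omega> \<in> space M. X j \<omega> \<in> B} = measure lborel ({0..1} \<inter> B)"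
proof -
  have "prob {\<omega> \<in> space M. X j \<omega> \<in> B} = measure (distr M borel (X j)) B"
    using assms by (subst measure_distr) (auto intro!: measurable_X arg_cong[where f = prob])
  also have "\<dots> = measure lborel ({0..1} \<inter> B)"
    using assms by (simp add: uniform_X)
  finally show ?thesis .
qed

lemma prob_box:
  assumes "\<And>j. j < n \<Longrightarrow> B j \<in> sets borel"
  shows "prob {\<omega> \<in> space M. \<forall>j<n. X j \<omega> \<in> B j} = (\<Prod>j<n. measure lborel ({0..1} \<inter> B j))"
proof (cases "n = 0")
  case True
  then show ?thesis by (simp add: prob_space)
next
  case False
  have "{\<omega> \<in> space M. \<forall>j<n. X j \<omega> \<in> B j} = (\<Inter>j\<in>{..<n}. X j -` B j \<inter> space M)"
    using False by auto
  also have "prob \<dots> = (\<Prod>j<n. prob (X j -` B j \<inter> space M))"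
    using False assms by (intro indep_varsD[OF indep_X]) auto
  also have "\<dots> = (\<Prod>j<n. measure lborel ({0..1} \<inter> B j))"
  proof (intro prod.cong refl)
    fix j assume "j \<in> {..<n}"
    moreover have "X j -` B j \<inter> space M = {\<omega> \<in> space M. X j \<omega> \<in> B j}" by auto
    ultimately show "prob (X j -` B j \<inter> space M) = measure lborel ({0..1} \<inter> B j)"
      using prob_coordinate[of j "B j"] assms by auto
  qed
  finally show ?thesis .
qed

text \<open>The joint position of the sample relative to two levels: \<open>S\<close> collects the indices of points
  below \<open>s\<close>, and \<open>T\<close> indices of points in \<open>(s, t]\<close>. The remaining points are only asked to exceed
  \<open>s\<close>, not \<open>t\<close>: that suits an event of the form ``at least \<open>m\<close> points in \<open>(s, t]\<close>'', which is a union
  of such cells over all \<open>T\<close> of size \<open>m\<close>.\<close>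
definition cell :: "real \<Rightarrow> real \<Rightarrow> nat set \<Rightarrow> nat set \<Rightarrow> 'a set" where
  "cell s t S T = {\<omega> \<in> space M. \<forall>j<n. X j \<omega> \<in>
     (if j \<in> S then {..s} else if j \<in> T then {s<..t} else {s<..})}"

lemma cell_in_events: "cell s t S T \<in> events"
  unfolding cell_def by (rule box_in_events) auto

lemma prob_cell:
  assumes "0 \<le> s" "s \<le> t" "t \<le> 1" "S \<subseteq> {..<n}" "T \<subseteq> {..<n} - S"
  shows "prob (cell s t S T) = s ^ card S * (t - s) ^ card T * (1 - s) ^ (n - card S - card T)"
proof -
  let ?B = "\<lambda>j. if j \<in> S then {..s} else if j \<in> T then {s<..t} else {s<..}"
  have fin: "finite S" "finite T" using assms by (auto intro: finite_subset[of _ "{..<n}"])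
  have m: "{0..1} \<inter> {..s} = {0..s}" "{0..1} \<inter> {s<..t} = {s<..t}" "{0..1} \<inter> {s<..} = {s<..1}"
    using assms by auto
  have "prob (cell s t S T) = (\<Prod>j<n. measure lborel ({0..1} \<inter> ?B j))"
    unfolding cell_def by (rule prob_box) auto
  also have "\<dots> = (\<Prod>j<n. if j \<in> S then s else if j \<in> T then t - s else 1 - s)"
    using assms by (intro prod.cong refl) (auto simp: m)
  also have "{..<n} = S \<union> (T \<union> ({..<n} - S - T))" using assms by auto
  also have "(\<Prod>j\<in>\<dots>. if j \<in> S then s else if j \<in> T then t - s else 1 - s)
     = s ^ card S * ((t - s) ^ card T * (1 - s) ^ card ({..<n} - S - T))"
    using assms fin
  proof -
    have "(\<Prod>j\<in>T \<union> ({..<n} - S - T). f j) = (\<Prod>j\<in>T. f j) * (\<Prod>j\<in>{..<n} - S - T. f j)" for f :: "nat \<Rightarrow> real"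
      using fin by (intro prod.union_disjoint) auto
    moreover have "(\<Prod>j\<in>S \<union> (T \<union> ({..<n} - S - T)). f j) = (\<Prod>j\<in>S. f j) * (\<Prod>j\<in>T \<union> ({..<n} - S - T). f j)" for f :: "nat \<Rightarrow> real"
      using fin assms by (intro prod.union_disjoint) auto
    moreover have "(\<Prod>j\<in>T. if j \<in> S then s else if j \<in> T then t - s else 1 - s) = (\<Prod>j\<in>T. t - s)"
      using assms by (intro prod.cong) auto
    ultimately show ?thesis by simp
  qed
  also have "card ({..<n} - S - T) = n - card S - card T"
    using assms fin by (simp add: card_Diff_subset)
  finally show ?thesis by (simp add: mult.assoc)
qed

lemma cell_below: "S \<subseteq> {..<n} \<Longrightarrow> cell t t S {} = {\<omega> \<in> space M. below t \<omega> = S}"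
proof -
  assume S: "S \<subseteq> {..<n}"
  have *: "y \<in> (if j \<in> S then {..t} else if j \<in> {} then {t<..t} else {t<..}) \<longleftrightarrow> (j \<in> S \<longleftrightarrow> y \<le> t)"
    for j :: nat and y :: real
    by auto
  have "(\<forall>j<n. j \<in> S \<longleftrightarrow> X j \<omega> \<le> t) \<longleftrightarrow> below t \<omega> = S" for \<omega>
    using S by (auto simp: below_def)
  then show ?thesis
    unfolding cell_def * by simp
qed

lemma below_eq_in_events:
  "S \<subseteq> {..<n} \<Longrightarrow> {\<omega> \<in> space M. below t \<omega> = S} \<in> events"
  using cell_in_events[of t t S "{}"] by (simp only: cell_below)

lemma below_pred_in_events: "{\<omega> \<in> space M. P (below t \<omega>)} \<in> events"
proof -
  have "{\<omega> \<in> space M. P (below t \<omega>)} = (\<Union>S\<in>{S\<in>Pow {..<n}. P S}. {\<omega> \<in> space M. below t \<omega> = S})"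
    using below_subset by blast
  also have "\<dots> \<in> events" by (intro sets.finite_UN) (auto intro: below_eq_in_events)
  finally show ?thesis .
qed

lemma prob_card_below_eq:
  assumes "0 \<le> t" "t \<le> 1"
  shows "prob {\<omega> \<in> space M. card (below t \<omega>) = k} = binom_prob n k t"
proof -
  let ?I = "{S. S \<subseteq> {..<n} \<and> card S = k}"
  have "{\<omega> \<in> space M. card (below t \<omega>) = k} = (\<Union>S\<in>?I. {\<omega> \<in> space M. below t \<omega> = S})"
    using below_subset by blast
  also have "prob \<dots> = (\<Sum>S\<in>?I. prob {\<omega> \<in> space M. below t \<omega> = S})"
    by (intro finite_measure_finite_Union) (auto simp: disjoint_family_on_def intro: below_eq_in_events)
  also have "\<dots> = (\<Sum>S\<in>?I. t ^ k * (1 - t) ^ (n - k))"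
  proof (intro sum.cong refl)
    fix S assume "S \<in> ?I"
    then show "prob {\<omega> \<in> space M. below t \<omega> = S} = t ^ k * (1 - t) ^ (n - k)"
      using cell_below[of S t] prob_cell[of t t S "{}"] assms by simp
  qed
  also have "\<dots> = binom_prob n k t"
    using n_subsets[of "{..<n}" k] by (simp add: binom_prob_def)
  finally show ?thesis .
qed

lemma prob_card_below_ge:
  assumes "0 \<le> t" "t \<le> 1"
  shows "prob {\<omega> \<in> space M. k \<le> card (below t \<omega>)} = (\<Sum>m = k..n. binom_prob n m t)"
proof -
  have "card (below t \<omega>) \<le> n" for \<omega>
    using card_mono[OF _ below_subset[of t \<omega>]] by simp
  then have "{\<omega> \<in> space M. k \<le> card (below t \<omega>)} = (\<Union>m\<in>{k..n}. {\<omega> \<in> space M. card (below t \<omega>) = m})"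
    by auto
  also have "prob \<dots> = (\<Sum>m\<in>{k..n}. prob {\<omega> \<in> space M. card (below t \<omega>) = m})"
    by (intro finite_measure_finite_Union)
       (auto simp: disjoint_family_on_def intro: below_pred_in_events[where P = "\<lambda>S. card S = _"])
  finally show ?thesis using assms by (simp add: prob_card_below_eq)
qed

text \<open>A union bound over the choice of the \<open>k\<close> points below \<open>s\<close> and of \<open>m\<close> further points in \<open>(s, t]\<close>.
  The factor of \<open>binom_prob n k s\<close> bounds the conditional probability that \<open>t\<close> has \<open>m\<close> further
  points below it, as the points above \<open>s\<close> are uniform on \<open>(s, 1]\<close>.\<close>
lemma prob_two_levels_le:
  assumes "0 \<le> s" "s \<le> t" "t \<le> 1" "s < 1"
  shows "prob {\<omega> \<in> space M. card (below s \<omega>) = k \<and> k + m \<le> card (below t \<omega>)}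
     \<le> binom_prob n k s * (real ((n - k) choose m) * ((t - s) / (1 - s)) ^ m)"
proof -
  let ?A = "{\<omega> \<in> space M. card (below s \<omega>) = k \<and> k + m \<le> card (below t \<omega>)}"
  let ?I = "SIGMA S : {S. S \<subseteq> {..<n} \<and> card S = k}. {T. T \<subseteq> {..<n} - S \<and> card T = m}"
  have finI: "finite ?I" by (intro finite_SigmaI) auto
  have "?A \<subseteq> (\<Union>(S, T)\<in>?I. cell s t S T)"
  proof
    fix \<omega> assume \<omega>: "\<omega> \<in> ?A"
    have "below s \<omega> \<subseteq> below t \<omega>" using assms by (auto simp: below_def)
    then have "m \<le> card (below t \<omega> - below s \<omega>)"
      using \<omega> card_Diff_subset[of "below s \<omega>" "below t \<omega>"] by auto
    then obtain T where T: "T \<subseteq> below t \<omega> - below s \<omega>" "card T = m"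
      by (meson obtain_subset_with_card_n)
    then have "\<omega> \<in> cell s t (below s \<omega>) T"
      using \<omega> by (auto simp: cell_def below_def)
    moreover have "(below s \<omega>, T) \<in> ?I"
      using T \<omega> below_subset by blast
    ultimately show "\<omega> \<in> (\<Union>(S, T)\<in>?I. cell s t S T)" by blast
  qed
  then have "prob ?A \<le> prob (\<Union>(S, T)\<in>?I. cell s t S T)"
    using finI by (intro finite_measure_mono sets.finite_UN) (auto intro: cell_in_events)
  also have "\<dots> \<le> (\<Sum>(S, T)\<in>?I. prob (cell s t S T))"
    unfolding case_prod_unfold
    using finI by (intro finite_measure_subadditive_finite) (auto intro: cell_in_events)
  also have "\<dots> = (\<Sum>(S, T)\<in>?I. s ^ k * (t - s) ^ m * (1 - s) ^ (n - k - m))"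
    using assms by (intro sum.cong refl) (auto simp: prob_cell)
  also have "\<dots> = real (card ?I) * (s ^ k * (t - s) ^ m * (1 - s) ^ (n - k - m))"
    by simp
  also have "card ?I = (n choose k) * ((n - k) choose m)"
  proof -
    have "card ?I = (\<Sum>S\<in>{S. S \<subseteq> {..<n} \<and> card S = k}. card {T. T \<subseteq> {..<n} - S \<and> card T = m})"
      by (intro card_SigmaI) auto
    also have "\<dots> = (\<Sum>S\<in>{S. S \<subseteq> {..<n} \<and> card S = k}. (n - k) choose m)"
    proof (intro sum.cong refl)
      fix S assume "S \<in> {S. S \<subseteq> {..<n} \<and> card S = k}"
      then have "card ({..<n} - S) = n - k" "finite ({..<n} - S)"
        using finite_subset[of S "{..<n}"] by (auto simp: card_Diff_subset)
      then show "card {T. T \<subseteq> {..<n} - S \<and> card T = m} = (n - k) choose m"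
        using n_subsets by metis
    qed
    also have "\<dots> = (n choose k) * ((n - k) choose m)"
      using n_subsets[of "{..<n}" k] by simp
    finally show ?thesis .
  qed
  also have "real ((n choose k) * ((n - k) choose m)) * (s ^ k * (t - s) ^ m * (1 - s) ^ (n - k - m))
     = binom_prob n k s * (real ((n - k) choose m) * ((t - s) / (1 - s)) ^ m)"
  proof (cases "m \<le> n - k")
    case True
    then have "(1 - s) ^ (n - k) = (1 - s) ^ (n - k - m) * (1 - s) ^ m"
      by (metis le_add_diff_inverse2 power_add)
    then show ?thesis using assms by (simp add: binom_prob_def power_divide)
  qed (simp add: binomial_eq_0)
  finally show ?thesis .
qed

end

section \<open>Binomial probabilities\<close>

lemma binom_prob_nonneg: "0 \<le> c \<Longrightarrow> c \<le> 1 \<Longrightarrow> 0 \<le> binom_prob n k c"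
  by (simp add: binom_prob_def)

lemma binom_prob_le_1: "0 \<le> c \<Longrightarrow> c \<le> 1 \<Longrightarrow> binom_prob n k c \<le> 1"
  using pmf_le_1[of "binomial_pmf n c" k] by (simp add: binom_prob_def pmf_binomial)

text \<open>The ratio of consecutive probabilities, multiplied out to avoid division. It decreases in \<open>m\<close>,
  which is why a binomial tail is dominated by a geometric series.\<close>
lemma binom_prob_Suc:
  assumes "m < n"
  shows "binom_prob n (Suc m) t * (real (Suc m) * (1 - t)) = binom_prob n m t * (real (n - m) * t)"
proof -
  have "Suc m * (n choose Suc m) = (n - m) * (n choose m)"
    by (simp only: binomial_absorption binomial_absorb_comp)
  then have *: "real (Suc m) * real (n choose Suc m) = real (n - m) * real (n choose m)"
    by (metis of_nat_mult)
  have **: "(1 - t) ^ (n - m) = (1 - t) * (1 - t) ^ (n - Suc m)"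
    using assms by (metis Suc_diff_Suc power_Suc)
  have "binom_prob n (Suc m) t * (real (Suc m) * (1 - t))
      = (real (Suc m) * real (n choose Suc m)) * (t * t ^ m * ((1 - t) * (1 - t) ^ (n - Suc m)))"
    by (simp add: binom_prob_def del: of_nat_Suc)
  also have "\<dots> = binom_prob n m t * (real (n - m) * t)"
    unfolding * ** binom_prob_def by simp
  finally show ?thesis .
qed

lemma binom_prob_add_le:
  assumes t: "0 \<le> t" "t < 1" and q: "0 \<le> q"
    and ratio: "\<And>m. k \<le> m \<Longrightarrow> m < n \<Longrightarrow> real (n - m) * t \<le> q * (real (Suc m) * (1 - t))"
  shows "binom_prob n (k + j) t \<le> q ^ j * binom_prob n k t"
proof (induction j)
  case (Suc j)
  show ?case
  proof (cases "k + j < n")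
    case True
    have "binom_prob n (Suc (k + j)) t * (real (Suc (k + j)) * (1 - t))
        \<le> binom_prob n (k + j) t * (q * (real (Suc (k + j)) * (1 - t)))"
      unfolding binom_prob_Suc[OF True]
      using ratio[of "k + j"] True t by (intro mult_left_mono binom_prob_nonneg) auto
    then have "binom_prob n (Suc (k + j)) t * (real (Suc (k + j)) * (1 - t))
        \<le> (q * binom_prob n (k + j) t) * (real (Suc (k + j)) * (1 - t))"
      by (simp only: ac_simps)
    then have "binom_prob n (Suc (k + j)) t \<le> q * binom_prob n (k + j) t"
      by (rule mult_right_le_imp_le) (use t in simp)
    also have "\<dots> \<le> q * (q ^ j * binom_prob n k t)"
      using Suc q by (intro mult_left_mono)
    finally show ?thesis by (simp add: mult.assoc)
  next
    case False
    then have "binom_prob n (k + Suc j) t = 0"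
      by (simp add: binom_prob_def)
    then show ?thesis
      using q t binom_prob_nonneg[of t n k] by simp
  qed
qed simp

lemma binom_tail_le_geometric:
  assumes t: "0 \<le> t" "t < 1" and q: "0 \<le> q" and "k \<le> n"
    and ratio: "\<And>m. k \<le> m \<Longrightarrow> m < n \<Longrightarrow> real (n - m) * t \<le> q * (real (Suc m) * (1 - t))"
  shows "(\<Sum>m = k..n. binom_prob n m t) \<le> (\<Sum>j\<le>n - k. q ^ j) * binom_prob n k t"
proof -
  have "(\<Sum>m = k..n. binom_prob n m t) = (\<Sum>j\<le>n - k. binom_prob n (k + j) t)"
    using \<open>k \<le> n\<close>
    by (intro sum.reindex_bij_witness[of _ "\<lambda>j. k + j" "\<lambda>m. m - k"]) auto
  also have "\<dots> \<le> (\<Sum>j\<le>n - k. q ^ j * binom_prob n k t)"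
    using assms by (intro sum_mono binom_prob_add_le) auto
  finally show ?thesis by (simp add: sum_distrib_right)
qed

lemma binom_tail_le_of_small_mean:
  assumes t: "0 \<le> t" "t \<le> 1 / 2" and q: "0 \<le> q" "q < 1" and "k \<le> n"
    and mean: "2 * (real n * t) \<le> q * real k"
  shows "(\<Sum>m = k..n. binom_prob n m t) \<le> binom_prob n k t / (1 - q)"
proof -
  have "real (n - m) * t \<le> q * (real (Suc m) * (1 - t))" if "k \<le> m" for m
  proof -
    have "real (n - m) * t \<le> real n * t" using t by (intro mult_right_mono) auto
    also have "\<dots> \<le> q * (real k * (1 / 2))" using mean by simp
    also have "\<dots> \<le> q * (real (Suc m) * (1 - t))"
      using that t q by (intro mult_left_mono mult_mono) auto
    finally show ?thesis .
  qed
  with t q have "(\<Sum>m = k..n. binom_prob n m t) \<le> (\<Sum>j\<le>n - k. q ^ j) * binom_prob n k t"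
    by (intro binom_tail_le_geometric[OF _ _ _ \<open>k \<le> n\<close>]) (assumption | linarith)+
  also have "\<dots> \<le> (1 / (1 - q)) * binom_prob n k t"
  proof (intro mult_right_mono binom_prob_nonneg)
    have "(\<Sum>j\<le>n - k. q ^ j) \<le> (\<Sum>j. q ^ j)"
      using q by (intro sum_le_suminf summable_geometric) auto
    then show "(\<Sum>j\<le>n - k. q ^ j) \<le> 1 / (1 - q)"
      using q by (simp add: suminf_geometric)
  qed (use t in auto)
  finally show ?thesis by simp
qed

lemma binom_tail_le_of_mean_le:
  assumes t: "0 \<le> t" "t < 1" and "k \<le> n" and mean: "real n * t \<le> real k"
  shows "(\<Sum>m = k..n. binom_prob n m t) \<le> (real n + 1) * binom_prob n k t"
proof -
  have "real (n - m) * t \<le> 1 * (real (Suc m) * (1 - t))" if "k \<le> m" "m < n" for m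
    using that mean t by (simp add: of_nat_diff algebra_simps)
  then have "(\<Sum>m = k..n. binom_prob n m t) \<le> (\<Sum>j\<le>n - k. 1 ^ j) * binom_prob n k t"
    using assms by (intro binom_tail_le_geometric) auto
  also have "\<dots> \<le> (real n + 1) * binom_prob n k t"
    using t by (intro mult_right_mono binom_prob_nonneg) auto
  finally show ?thesis .
qed

text \<open>The large-deviation bound with the relative entropy as rate. It results from changing the success
  probability from \<open>c\<close> to \<open>k/n\<close>, since the likelihood ratio depends on the number of successes only.\<close>
lemma binom_prob_le_exp:
  assumes "0 < k" "k < n" "0 < c" "c < 1"
  defines "x \<equiv> real k / real n"
  shows "binom_prob n k c \<le> exp (- real n * (x * ln (x / c) + (1 - x) * ln ((1 - x) / (1 - c))))"
proof -
  have x: "0 < x" "x < 1" and kx: "real k = real n * x" and nkx: "real (n - k) = real n * (1 - x)"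
    using assms by (auto simp: x_def of_nat_diff field_simps)
  have pow: "y ^ m = exp (real m * ln y)" if "0 < y" for y :: real and m
    using that by (simp add: exp_of_nat_mult)
  have e: "- real n * (x * ln (x / c) + (1 - x) * ln ((1 - x) / (1 - c)))
      = real k * ln (c / x) + real (n - k) * ln ((1 - c) / (1 - x))"
    using x assms(3,4) unfolding kx nkx by (simp add: ln_div algebra_simps)
  have "binom_prob n k c = binom_prob n k x * ((c / x) ^ k * ((1 - c) / (1 - x)) ^ (n - k))"
    using x by (simp add: binom_prob_def power_divide)
  also have "\<dots> \<le> 1 * ((c / x) ^ k * ((1 - c) / (1 - x)) ^ (n - k))"
    using x assms(3,4) by (intro mult_right_mono binom_prob_le_1) auto
  also have "\<dots> = exp (- real n * (x * ln (x / c) + (1 - x) * ln ((1 - x) / (1 - c))))"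
    unfolding e exp_add using x assms(3,4) by (simp add: pow)
  finally show ?thesis .
qed

lemma power_div_fact_le_exp: "0 \<le> (x::real) \<Longrightarrow> x ^ m / fact m \<le> exp x"
  using sum_le_suminf[OF summable_exp_generic[of x], of "{m}"]
  by (simp add: exp_def field_simps)

text \<open>If a point falls into a given interval with probability \<open>z \<le> d m/n\<close>, the expected number of
  \<open>m\<close>-sets of points in it is at most \<open>(3d)^m\<close>, so it decays geometrically in \<open>m\<close> for small \<open>d\<close>. The reason is \<open>m^m / m! \<le> e^m \<le> 3^m\<close>.\<close>
lemma choose_mult_power_le:
  assumes "0 \<le> z" "real n * z \<le> d * real m" "0 \<le> d" "N \<le> n"
  shows "real (N choose m) * z ^ m \<le> (3 * d) ^ m"
proof -
  have "(N choose m) * fact m \<le> n ^ m"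
    using binomial_fact_pow[of N m] power_mono[OF \<open>N \<le> n\<close>, of m] by simp
  then have "real ((N choose m) * fact m) \<le> real (n ^ m)"
    by (rule of_nat_mono)
  then have "real (N choose m) \<le> real n ^ m / fact m"
    by (simp add: field_simps)
  then have "real (N choose m) * z ^ m \<le> real n ^ m / fact m * z ^ m"
    using assms by (intro mult_right_mono) auto
  also have "\<dots> = (real n * z) ^ m / fact m" by (simp add: power_mult_distrib)
  also have "\<dots> \<le> (d * real m) ^ m / fact m"
    using assms by (intro divide_right_mono power_mono) auto
  also have "\<dots> = d ^ m * (real m ^ m / fact m)" by (simp add: power_mult_distrib)
  also have "\<dots> \<le> d ^ m * exp (real m)"
    using assms by (intro mult_left_mono power_div_fact_le_exp) auto
  also have "exp (real m) = exp 1 ^ m" by (simp flip: exp_of_nat_mult)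
  also have "d ^ m * exp 1 ^ m \<le> d ^ m * 3 ^ m"
    using assms exp_le by (intro mult_left_mono power_mono) auto
  finally show ?thesis by (simp add: power_mult_distrib mult.commute)
qed

section \<open>Hitting a sequence of levels\<close>

context uniform_sample
begin

lemma prob_below_ge_le_of_small_mean:
  assumes "0 \<le> t" "t \<le> 1 / 2" "0 \<le> q" "q < 1" "k \<le> n" "2 * (real n * t) \<le> q * real k"
  shows "prob {\<omega> \<in> space M. k \<le> card (below t \<omega>)} \<le> binom_prob n k t / (1 - q)"
  using assms prob_card_below_ge[of t k] binom_tail_le_of_small_mean[of t q k n] by simp

lemma prob_below_ge_le_of_mean_le:
  assumes "0 \<le> t" "t < 1" "k \<le> n" "real n * t \<le> real k"
  shows "prob {\<omega> \<in> space M. k \<le> card (below t \<omega>)} \<le> (real n + 1) * binom_prob n k t"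
  using assms prob_card_below_ge[of t k] binom_tail_le_of_mean_le[of t k n] by simp

text \<open>The disjoint events behind the lower bound: the level with index \<open>k\<close> is hit with exactly \<open>k\<close> points, and
  no level with a larger index up to \<open>K\<close> is hit.\<close>
definition last_hit :: "nat \<Rightarrow> (nat \<Rightarrow> real) \<Rightarrow> nat \<Rightarrow> 'a set" where
  "last_hit K c k = {\<omega> \<in> space M. card (below (c k) \<omega>) = k} -
     (\<Union>l\<in>{k<..K}. {\<omega> \<in> space M. card (below (c k) \<omega>) = k \<and> l \<le> card (below (c l) \<omega>)})"

lemma two_levels_in_events:
  "{\<omega> \<in> space M. card (below s \<omega>) = k \<and> l \<le> card (below t \<omega>)} \<in> events"
proof -
  have "{\<omega> \<in> space M. card (below s \<omega>) = k \<and> l \<le> card (below t \<omega>)}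
      = {\<omega> \<in> space M. card (below s \<omega>) = k} \<inter> {\<omega> \<in> space M. l \<le> card (below t \<omega>)}"
    by blast
  also have "\<dots> \<in> events"
    by (intro sets.Int below_pred_in_events[where P = "\<lambda>S. card S = k"]
              below_pred_in_events[where P = "\<lambda>S. l \<le> card S"])
  finally show ?thesis .
qed

lemma last_hit_in_events: "last_hit K c k \<in> events"
  unfolding last_hit_def
  by (intro sets.Diff sets.finite_UN two_levels_in_events
            below_pred_in_events[where P = "\<lambda>S. card S = k"]) simp

lemma disjoint_last_hit: "disjoint_family_on (last_hit K c) {k0..K}"
proof -
  have "last_hit K c k \<inter> last_hit K c l = {}" if "k < l" "l \<le> K" for k l
    unfolding last_hit_def using that by auto
  then show ?thesis
    unfolding disjoint_family_on_def by (metis Int_commute atLeastAtMost_iff linorder_neqE_nat)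
qed

text \<open>The later hits are removed by a union bound over \<open>l > k\<close>. As the levels rise slowly, hitting the
  level with index \<open>l\<close> has conditional probability at most \<open>(6d)^(l - k)\<close>. One factor \<open>2\<close> in \<open>6\<close>
  absorbs \<open>1 - c k \<ge> 1/2\<close>, the other factor \<open>3\<close> comes from \<open>choose_mult_power_le\<close>.\<close>
lemma prob_last_hit_ge:
  assumes "K \<le> n" "k \<le> K" "0 \<le> c k"
    and half: "\<And>l. k \<le> l \<Longrightarrow> l \<le> K \<Longrightarrow> c l \<le> 1 / 2"
    and mono: "\<And>l. k < l \<Longrightarrow> l \<le> K \<Longrightarrow> c k \<le> c l"
    and slope: "\<And>l. k < l \<Longrightarrow> l \<le> K \<Longrightarrow> real n * (c l - c k) \<le> d * real (l - k)"
    and d: "0 \<le> d" "6 * d < 1"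
  shows "(1 - 6 * d / (1 - 6 * d)) * binom_prob n k (c k) \<le> prob (last_hit K c k)"
proof -
  let ?H = "{\<omega> \<in> space M. card (below (c k) \<omega>) = k}"
  let ?R = "\<lambda>l. {\<omega> \<in> space M. card (below (c k) \<omega>) = k \<and> l \<le> card (below (c l) \<omega>)}"
  have ck: "c k \<le> 1 / 2" using half assms by auto
  have R: "prob (?R l) \<le> binom_prob n k (c k) * (6 * d) ^ (l - k)" if l: "l \<in> {k<..K}" for l
  proof -
    have le: "0 \<le> c l - c k" "c l \<le> 1 / 2" using l mono half by auto
    have "(c l - c k) / (1 - c k) \<le> (c l - c k) / (1 / 2)"
      using le ck by (intro divide_left_mono) auto
    then have "real n * ((c l - c k) / (1 - c k)) \<le> real n * ((c l - c k) / (1 / 2))"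
      by (intro mult_left_mono) auto
    also have "\<dots> \<le> 2 * d * real (l - k)"
      using slope[of l] l by (simp add: algebra_simps)
    finally have z: "real n * ((c l - c k) / (1 - c k)) \<le> 2 * d * real (l - k)" .
    have "prob (?R l) \<le> binom_prob n k (c k) *
        (real ((n - k) choose (l - k)) * ((c l - c k) / (1 - c k)) ^ (l - k))"
      using prob_two_levels_le[of "c k" "c l" k "l - k"] le ck l \<open>0 \<le> c k\<close> by auto
    also have "\<dots> \<le> binom_prob n k (c k) * (3 * (2 * d)) ^ (l - k)"
      using z d le ck \<open>0 \<le> c k\<close>
      by (intro mult_left_mono choose_mult_power_le[of _ n] binom_prob_nonneg) auto
    finally show ?thesis by simp
  qed
  have "(\<Sum>l\<in>{k<..K}. (6 * d) ^ (l - k)) = (\<Sum>j\<in>{1..K - k}. (6 * d) ^ j)"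
    by (intro sum.reindex_bij_witness[of _ "\<lambda>j. k + j" "\<lambda>l. l - k"]) auto
  also have "\<dots> = (\<Sum>j\<in>{1..K - k}. 6 * d * (6 * d) ^ (j - 1))"
    by (intro sum.cong refl) (metis One_nat_def Suc_le_D atLeastAtMost_iff diff_Suc_1 power_Suc)
  also have "\<dots> = 6 * d * (\<Sum>j\<in>{..<K - k}. (6 * d) ^ j)"
    unfolding sum_distrib_left
    by (intro sum.reindex_bij_witness[of _ Suc "\<lambda>j. j - 1"]) auto
  also have "\<dots> \<le> 6 * d * (\<Sum>j. (6 * d) ^ j)"
    using d by (intro mult_left_mono sum_le_suminf summable_geometric) auto
  also have "\<dots> = 6 * d / (1 - 6 * d)"
    using d suminf_geometric[of "6 * d"] by (simp del: power_mult_distrib)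
  finally have geo: "(\<Sum>l\<in>{k<..K}. (6 * d) ^ (l - k)) \<le> 6 * d / (1 - 6 * d)" .
  have "?H \<subseteq> last_hit K c k \<union> (\<Union>l\<in>{k<..K}. ?R l)"
    unfolding last_hit_def by blast
  moreover have "(\<Union>l\<in>{k<..K}. ?R l) \<in> events"
    by (intro sets.finite_UN two_levels_in_events) simp
  ultimately have "prob ?H \<le> prob (last_hit K c k \<union> (\<Union>l\<in>{k<..K}. ?R l))"
    by (intro finite_measure_mono sets.Un last_hit_in_events)
  also have "\<dots> \<le> prob (last_hit K c k) + prob (\<Union>l\<in>{k<..K}. ?R l)"
    using \<open>(\<Union>l\<in>{k<..K}. ?R l) \<in> events\<close> by (intro measure_Un_le last_hit_in_events)
  also have "prob (\<Union>l\<in>{k<..K}. ?R l) \<le> (\<Sum>l\<in>{k<..K}. prob (?R l))"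
    by (intro finite_measure_subadditive_finite image_subsetI two_levels_in_events) simp
  also have "\<dots> \<le> (\<Sum>l\<in>{k<..K}. binom_prob n k (c k) * (6 * d) ^ (l - k))"
    by (intro sum_mono R)
  also have "\<dots> \<le> binom_prob n k (c k) * (6 * d / (1 - 6 * d))"
    unfolding sum_distrib_left[symmetric]
    using geo ck \<open>0 \<le> c k\<close> by (intro mult_left_mono binom_prob_nonneg) auto
  finally show ?thesis
    using prob_card_below_eq[of "c k" k] ck \<open>0 \<le> c k\<close> by (simp add: algebra_simps)
qed

lemma prob_hit_ge:
  assumes "K \<le> n"
    and range: "\<And>k. k0 \<le> k \<Longrightarrow> k \<le> K \<Longrightarrow> 0 \<le> c k \<and> c k \<le> 1 / 2"
    and mono: "\<And>k l. k0 \<le> k \<Longrightarrow> k < l \<Longrightarrow> l \<le> K \<Longrightarrow> c k \<le> c l"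
    and slope: "\<And>k l. k0 \<le> k \<Longrightarrow> k < l \<Longrightarrow> l \<le> K \<Longrightarrow> real n * (c l - c k) \<le> d * real (l - k)"
    and d: "0 \<le> d" "6 * d < 1"
  shows "(1 - 6 * d / (1 - 6 * d)) * (\<Sum>k = k0..K. binom_prob n k (c k))
    \<le> prob (\<Union>k\<in>{k0..K}. {\<omega> \<in> space M. k \<le> card (below (c k) \<omega>)})"
proof -
  have "(1 - 6 * d / (1 - 6 * d)) * (\<Sum>k = k0..K. binom_prob n k (c k))
      = (\<Sum>k = k0..K. (1 - 6 * d / (1 - 6 * d)) * binom_prob n k (c k))"
    by (rule sum_distrib_left)
  also have "\<dots> \<le> (\<Sum>k = k0..K. prob (last_hit K c k))"
    using assms by (intro sum_mono prob_last_hit_ge) auto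
  also have "\<dots> = prob (\<Union>k\<in>{k0..K}. last_hit K c k)"
    by (intro finite_measure_finite_Union[symmetric] disjoint_last_hit image_subsetI last_hit_in_events) simp
  also have "\<dots> \<le> prob (\<Union>k\<in>{k0..K}. {\<omega> \<in> space M. k \<le> card (below (c k) \<omega>)})"
  proof (rule finite_measure_mono)
    show "(\<Union>k\<in>{k0..K}. last_hit K c k) \<subseteq> (\<Union>k\<in>{k0..K}. {\<omega> \<in> space M. k \<le> card (below (c k) \<omega>)})"
      unfolding last_hit_def by fastforce
    show "(\<Union>k\<in>{k0..K}. {\<omega> \<in> space M. k \<le> card (below (c k) \<omega>)}) \<in> events"
      by (intro sets.finite_UN below_pred_in_events) simp
  qed
  finally show ?thesis .
qed

end

section \<open>Boundary curves that are flat at the origin\<close>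

text \<open>The properties of the boundary curves that drive the asymptotics. The constant \<open>\<rho>\<close> is the exponential
  rate of decay in \<open>n\<close> of the probability that exactly \<open>k\<close> points lie below \<open>C(k/n)\<close>, for fixed \<open>k\<close>; \<open>rate_ge\<close> and \<open>rate_lim\<close> say that the rate is nowhere
  smaller than this limit at \<open>0\<close>, so that small indices dominate.\<close>
locale flat_boundary =
  fixes C D :: "real \<Rightarrow> real" and \<rho> :: real
  assumes C_pos: "0 < x \<Longrightarrow> x < 1 \<Longrightarrow> 0 < C x"
    and C_less: "0 < x \<Longrightarrow> x < 1 \<Longrightarrow> C x < x"
    and C_has_deriv: "0 < x \<Longrightarrow> x < 1 \<Longrightarrow> (C has_real_derivative D x) (at x)"
    and D_nonneg: "0 < x \<Longrightarrow> x < 1 \<Longrightarrow> 0 \<le> D x"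
    and D_continuous: "continuous_on {0<..<1} D"
    and D_flat: "(D \<longlongrightarrow> 0) (at_right 0)"
    and rate_ge: "0 < x \<Longrightarrow> x < 1 \<Longrightarrow> \<rho> \<le> x * ln (x / C x) - (x - C x)"
    and rate_lim: "((\<lambda>x. x * ln (1 / C x)) \<longlongrightarrow> \<rho>) (at_right 0)"
begin

lemma C_continuous: "continuous_on {0<..<1} C"
  by (intro continuous_at_imp_continuous_on ballI DERIV_isCont[OF C_has_deriv]) auto

lemma flat_near_0:
  assumes "0 < \<delta>" "0 < b"
  shows "\<exists>\<epsilon>. 0 < \<epsilon> \<and> \<epsilon> < b \<and> (\<forall>x. 0 < x \<and> x \<le> \<epsilon> \<longrightarrow> D x \<le> \<delta>)"
proof -
  have "\<forall>\<^sub>F x in at_right 0. D x < \<delta>"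
    using order_tendstoD(2)[OF D_flat] \<open>0 < \<delta>\<close> by blast
  then obtain a where a: "0 < a" "\<And>x. 0 < x \<Longrightarrow> x < a \<Longrightarrow> D x < \<delta>"
    unfolding eventually_at_right_field by blast
  define \<epsilon> where "\<epsilon> = min a b / 2"
  have "0 < \<epsilon>" "\<epsilon> < a" "\<epsilon> < b" using a assms by (auto simp: \<epsilon>_def)
  then show ?thesis using a(2) by (intro exI[of _ \<epsilon>]) (force intro: less_imp_le)
qed

lemma C_increment:
  assumes "0 < x" "x < y" "y \<le> \<epsilon>" "\<epsilon> < 1" and flat: "\<And>z. 0 < z \<Longrightarrow> z \<le> \<epsilon> \<Longrightarrow> D z \<le> \<delta>"
  shows "C x \<le> C y" "C y - C x \<le> \<delta> * (y - x)"
proof -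
  obtain z where z: "x < z" "z < y" "C y - C x = (y - x) * D z"
    using MVT2[OF \<open>x < y\<close>, of C D] C_has_deriv assms by force
  have "0 \<le> D z" "D z \<le> \<delta>" using D_nonneg[of z] flat[of z] z assms by auto
  then have "0 \<le> (y - x) * D z" "(y - x) * D z \<le> (y - x) * \<delta>"
    using \<open>x < y\<close> by (auto intro: mult_left_mono)
  then show "C x \<le> C y" "C y - C x \<le> \<delta> * (y - x)"
    using z by (auto simp: mult.commute)
qed

lemma C_le_linear:
  assumes "0 < x" "x \<le> \<epsilon>" "\<epsilon> < 1" "0 < \<delta>" and flat: "\<And>z. 0 < z \<Longrightarrow> z \<le> \<epsilon> \<Longrightarrow> D z \<le> \<delta>"
  shows "C x \<le> \<delta> * x"
proof (rule field_le_epsilon)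
  fix e :: real assume "0 < e"
  define y where "y = min e (x / 2)"
  have y: "0 < y" "y < x" "y \<le> e" using assms \<open>0 < e\<close> by (auto simp: y_def)
  have "C x - C y \<le> \<delta> * (x - y)" using C_increment[of y x \<epsilon> \<delta>] y assms by auto
  also have "\<dots> \<le> \<delta> * x" using y assms by (intro mult_left_mono) auto
  finally show "C x \<le> \<delta> * x + e" using C_less[of y] y assms by linarith
qed

text \<open>The part of the relative entropy that remains after splitting off the Poisson-type term in
  \<open>rate_ge\<close>. It is itself the rate of a Poisson variable of mean \<open>1 - C x\<close> at the value \<open>1 - x\<close>, so it
  vanishes only if \<open>C x = x\<close>.\<close>
definition excess :: "real \<Rightarrow> real" where
  "excess x = (1 - x) * ln ((1 - x) / (1 - C x)) + (x - C x)"

lemma excess_pos: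
  assumes x: "0 < x" "x < 1"
  shows "0 < excess x"
proof -
  define t where "t = (1 - C x) / (1 - x)"
  have t: "1 < t" using C_less[OF x] x by (simp add: t_def)
  then have "ln t < t - 1" using ln_le_minus_one[of t] ln_eq_minus_one[of t] by fastforce
  then have "(1 - x) * ln t < (1 - x) * (t - 1)" using x by (intro mult_strict_left_mono) auto
  moreover have "(1 - x) * (t - 1) = x - C x" using x by (simp add: t_def field_simps)
  moreover have "ln ((1 - x) / (1 - C x)) = - ln t"
    using x C_less[OF x] by (simp add: t_def ln_div)
  ultimately show ?thesis by (simp add: excess_def)
qed

lemma excess_bounded_below:
  assumes "0 < \<epsilon>" "\<epsilon> \<le> b" "b < 1"
  obtains \<kappa> where "0 < \<kappa>" "\<And>x. \<epsilon> \<le> x \<Longrightarrow> x \<le> b \<Longrightarrow> \<kappa> \<le> excess x"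
proof -
  have sub: "{\<epsilon>..b} \<subseteq> {0<..<1}" using assms by auto
  have cont: "continuous_on {\<epsilon>..b} C" using C_continuous continuous_on_subset sub by blast
  have "continuous_on {\<epsilon>..b} excess"
    unfolding excess_def
  proof (intro continuous_intros cont)
    show "\<forall>x\<in>{\<epsilon>..b}. 1 - C x \<noteq> 0" "\<forall>x\<in>{\<epsilon>..b}. (1 - x) / (1 - C x) \<noteq> 0"
      using C_less sub by force+
  qed
  moreover have "{\<epsilon>..b} \<noteq> {}" using assms by auto
  ultimately obtain x where x: "x \<in> {\<epsilon>..b}" "\<And>y. y \<in> {\<epsilon>..b} \<Longrightarrow> excess x \<le> excess y"
    using continuous_attains_inf[of "{\<epsilon>..b}" excess] by auto
  show ?thesis
    by (rule that[of "excess x"]) (use x excess_pos sub in auto)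
qed

lemma slope_ratio_bounded:
  assumes "0 < \<epsilon>" "\<epsilon> \<le> b" "b < 1"
  obtains B where "0 \<le> B" "\<And>x. \<epsilon> \<le> x \<Longrightarrow> x \<le> b \<Longrightarrow> D x / (1 - C x) \<le> B"
proof -
  have sub: "{\<epsilon>..b} \<subseteq> {0<..<1}" using assms by auto
  have cont: "continuous_on {\<epsilon>..b} C" "continuous_on {\<epsilon>..b} D"
    using C_continuous D_continuous continuous_on_subset sub by blast+
  have "continuous_on {\<epsilon>..b} (\<lambda>x. D x / (1 - C x))"
    by (intro continuous_intros cont) (use C_less sub in force)
  moreover have "{\<epsilon>..b} \<noteq> {}" using assms by auto
  ultimately obtain x where x: "x \<in> {\<epsilon>..b}"
      "\<And>y. y \<in> {\<epsilon>..b} \<Longrightarrow> D y / (1 - C y) \<le> D x / (1 - C x)"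
    using continuous_attains_sup[of "{\<epsilon>..b}" "\<lambda>x. D x / (1 - C x)"] by auto
  have "0 \<le> D x" "0 \<le> 1 - C x" using x(1) sub D_nonneg[of x] C_less[of x] by auto
  then show ?thesis
    by (intro that[of "D x / (1 - C x)"]) (use x in auto)
qed

abbreviation hit_prob :: "nat \<Rightarrow> nat \<Rightarrow> real" where
  "hit_prob n k \<equiv> binom_prob n k (C (real k / real n))"

lemma frac_range:
  assumes "1 \<le> k" "k < n"
  shows "0 < real k / real n" "real k / real n < 1"
  using assms by auto

lemma C_frac_range:
  assumes "1 \<le> k" "k < n"
  shows "0 < C (real k / real n)" "C (real k / real n) < 1"
  using C_pos[OF frac_range[OF assms]] C_less[OF frac_range[OF assms]] frac_range[OF assms] by auto

lemma hit_prob_nonneg: "1 \<le> k \<Longrightarrow> k < n \<Longrightarrow> 0 \<le> hit_prob n k"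
  using C_frac_range[of k n] by (intro binom_prob_nonneg) auto

lemma hit_prob_le_exp:
  assumes "1 \<le> k" "k < n"
  shows "hit_prob n k \<le> exp (- real n * (\<rho> + excess (real k / real n)))"
proof -
  define x where "x = real k / real n"
  have x: "0 < x" "x < 1" using frac_range[OF assms] by (auto simp: x_def)
  have "hit_prob n k \<le> exp (- real n * (x * ln (x / C x) + (1 - x) * ln ((1 - x) / (1 - C x))))"
    using binom_prob_le_exp[of k n "C x"] assms C_frac_range[OF assms] by (simp add: x_def)
  also have "\<dots> \<le> exp (- real n * (\<rho> + excess x))"
  proof -
    have "\<rho> + excess x \<le> x * ln (x / C x) + (1 - x) * ln ((1 - x) / (1 - C x))"
      using rate_ge[OF x] by (simp add: excess_def)
    then show ?thesis by (simp add: mult_left_mono)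
  qed
  finally show ?thesis by (simp add: x_def)
qed

lemma C_tendsto_0: "(C \<longlongrightarrow> 0) (at_right 0)"
proof (rule tendsto_sandwich)
  have ev: "\<forall>\<^sub>F x in at_right (0::real). 0 < x \<and> x < 1"
    by (intro eventually_at_rightI[of 0 1]) auto
  show "\<forall>\<^sub>F x in at_right 0. 0 \<le> C x" "\<forall>\<^sub>F x in at_right 0. C x \<le> x"
    using ev by (eventually_elim; use C_pos C_less in \<open>auto intro: less_imp_le\<close>)+
qed (auto intro: tendsto_ident_at)

text \<open>For fixed \<open>k\<close> and \<open>x = k/n\<close>, the factor \<open>C(x)^k\<close> is \<open>exp (-n x log (1/C(x)))\<close>, whose rate tends to
  \<open>\<rho>\<close>; the remaining factors cost nothing exponential because \<open>C(x) \<rightarrow> 0\<close>.\<close>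
lemma fixed_hit_prob_ge_exp:
  assumes k: "1 \<le> k" and "0 < \<kappa>"
  shows "\<forall>\<^sub>F n in sequentially. exp (- real n * (\<rho> + \<kappa>)) \<le> hit_prob n k"
proof -
  have lim: "filterlim (\<lambda>n. real k / real n) (at_right 0) sequentially"
    unfolding filterlim_at
  proof
    show "\<forall>\<^sub>F n in sequentially. real k / real n \<in> {0<..} \<and> real k / real n \<noteq> 0"
      using eventually_gt_at_top[of 0] by eventually_elim (use k in auto)
    show "(\<lambda>n. real k / real n) \<longlonglongrightarrow> 0" by real_asymp
  qed
  have "((\<lambda>x. ln (1 - C x)) \<longlongrightarrow> ln (1 - 0)) (at_right 0)"
    by (intro tendsto_intros C_tendsto_0) simp
  then have "\<forall>\<^sub>F x in at_right 0. - (\<kappa> / 2) < ln (1 - C x)"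
    using \<open>0 < \<kappa>\<close> by (intro order_tendstoD(1)) auto
  moreover have "\<forall>\<^sub>F x in at_right 0. x * ln (1 / C x) < \<rho> + \<kappa> / 2"
    using \<open>0 < \<kappa>\<close> by (intro order_tendstoD(2)[OF rate_lim]) auto
  ultimately have "\<forall>\<^sub>F x in at_right 0. - (\<kappa> / 2) < ln (1 - C x) \<and> x * ln (1 / C x) < \<rho> + \<kappa> / 2"
    by eventually_elim auto
  from eventually_compose_filterlim[OF this lim] eventually_gt_at_top[of k]
  show ?thesis
  proof eventually_elim
    case (elim n)
    define x where "x = real k / real n"
    have c: "0 < C x" "C x < 1" using C_frac_range[of k n] k elim by (auto simp: x_def)
    have kx: "real k = real n * x" using elim by (simp add: x_def)
    have "- real n * (\<rho> + \<kappa>) \<le> - (real n * (x * ln (1 / C x))) + real n * ln (1 - C x)"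
    proof -
      have "- (\<rho> + \<kappa>) \<le> - (x * ln (1 / C x)) + ln (1 - C x)"
        using elim by (simp add: x_def)
      from mult_left_mono[OF this, of "real n"] show ?thesis
        by (simp add: algebra_simps)
    qed
    also have "- (real n * (x * ln (1 / C x))) = real k * ln (C x)"
      using c unfolding kx by (simp add: ln_div)
    finally have "exp (- real n * (\<rho> + \<kappa>)) \<le> exp (real k * ln (C x) + real n * ln (1 - C x))"
      by simp
    also have "\<dots> = C x ^ k * (1 - C x) ^ n"
      using c by (simp add: exp_add exp_of_nat_mult)
    also have "\<dots> \<le> C x ^ k * (1 - C x) ^ (n - k)"
      using c by (intro mult_left_mono power_decreasing) auto
    also have "\<dots> \<le> real (n choose k) * (C x ^ k * (1 - C x) ^ (n - k))"
    proof -
      have "1 \<le> n choose k" using elim by (simp add: Suc_le_eq)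
      then have "1 \<le> real (n choose k)" by simp
      then show ?thesis using c mult_right_mono[of 1 "real (n choose k)" "C x ^ k * (1 - C x) ^ (n - k)"] by simp
    qed
    also have "\<dots> = hit_prob n k" by (simp add: binom_prob_def x_def)
    finally show ?case .
  qed
qed

text \<open>The gap \<open>\<kappa>\<close> between the rates is shared: half of it pays for comparing with the term \<open>k0\<close>, the other
  half beats the polynomial factor. That factor is quadratic since one power of \<open>n\<close> counts the
  indices and another one bounds a binomial tail by its first term.\<close>
lemma macroscopic_hits_negligible:
  assumes k0: "1 \<le> k0" and \<epsilon>: "0 < \<epsilon>" "\<epsilon> \<le> b" "b < 1" and "0 < \<eta>"
  shows "\<forall>\<^sub>F n in sequentially. \<forall>k. \<epsilon> * real n \<le> real k \<and> real k \<le> b * real n \<longrightarrow>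
           (real n + 1)\<^sup>2 * hit_prob n k \<le> \<eta> * hit_prob n k0"
proof -
  from excess_bounded_below[OF \<epsilon>] obtain \<kappa> where \<kappa>: "0 < \<kappa>"
    "\<And>x. \<epsilon> \<le> x \<Longrightarrow> x \<le> b \<Longrightarrow> \<kappa> \<le> excess x" by blast
  have "((\<lambda>n. (real n + 1)\<^sup>2 * exp (- real n * (\<kappa> / 2))) \<longlongrightarrow> 0) sequentially"
    using \<kappa>(1) by real_asymp
  then have "\<forall>\<^sub>F n in sequentially. (real n + 1)\<^sup>2 * exp (- real n * (\<kappa> / 2)) < \<eta>"
    using \<open>0 < \<eta>\<close> by (rule order_tendstoD(2))
  moreover have "\<forall>\<^sub>F n in sequentially. exp (- real n * (\<rho> + \<kappa> / 2)) \<le> hit_prob n k0"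
    using k0 \<kappa>(1) by (intro fixed_hit_prob_ge_exp) auto
  ultimately show ?thesis
    using eventually_gt_at_top[of 0]
  proof eventually_elim
    case (elim n)
    show ?case
    proof (intro allI impI)
      fix k assume k: "\<epsilon> * real n \<le> real k \<and> real k \<le> b * real n"
      have "0 < \<epsilon> * real n" "b * real n < 1 * real n"
        using elim \<epsilon> by (auto intro: mult_strict_right_mono)
      then have kn: "1 \<le> k" "k < n" using k by auto
      have "\<kappa> \<le> excess (real k / real n)"
        using k elim by (intro \<kappa>(2)) (auto simp: field_simps)
      then have "real n * (\<rho> + \<kappa>) \<le> real n * (\<rho> + excess (real k / real n))"
        by (intro mult_left_mono) auto
      then have "exp (- real n * (\<rho> + excess (real k / real n))) \<le> exp (- real n * (\<rho> + \<kappa>))"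
        by simp
      then have "hit_prob n k \<le> exp (- real n * (\<rho> + \<kappa>))"
        using order_trans[OF hit_prob_le_exp[OF kn]] by blast
      also have "\<dots> = exp (- real n * (\<kappa> / 2)) * exp (- real n * (\<rho> + \<kappa> / 2))"
        by (simp add: algebra_simps flip: exp_add)
      finally have "(real n + 1)\<^sup>2 * hit_prob n k
          \<le> (real n + 1)\<^sup>2 * (exp (- real n * (\<kappa> / 2)) * exp (- real n * (\<rho> + \<kappa> / 2)))"
        by (intro mult_left_mono) auto
      also have "\<dots> = ((real n + 1)\<^sup>2 * exp (- real n * (\<kappa> / 2))) * exp (- real n * (\<rho> + \<kappa> / 2))"
        by simp
      also have "\<dots> \<le> \<eta> * hit_prob n k0"
        using elim \<open>0 < \<eta>\<close> by (intro mult_mono) auto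
      finally show "(real n + 1)\<^sup>2 * hit_prob n k \<le> \<eta> * hit_prob n k0" .
    qed
  qed
qed

end

section \<open>First-order asymptotics of the hitting probability\<close>

lemma asymp_equiv_of_relative_error:
  fixes f g :: "nat \<Rightarrow> real"
  assumes "\<And>e. 0 < e \<Longrightarrow> \<forall>\<^sub>F n in sequentially. \<bar>f n - g n\<bar> \<le> e * g n"
  shows "f \<sim>[sequentially] g"
  unfolding asymp_equiv_def
proof (rule tendstoI)
  fix e :: real assume "0 < e"
  then have "\<forall>\<^sub>F n in sequentially. \<bar>f n - g n\<bar> \<le> e / 2 * g n" by (intro assms) simp
  then show "\<forall>\<^sub>F n in sequentially. dist (if f n = 0 \<and> g n = 0 then 1 else f n / g n) 1 < e"
  proof eventually_elim
    case (elim n)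
    show ?case
    proof (cases "g n = 0")
      case True
      then show ?thesis using elim \<open>0 < e\<close> by simp
    next
      case False
      have "0 \<le> e / 2 * g n" using elim abs_ge_zero[of "f n - g n"] by linarith
      then have g: "0 < g n" using False \<open>0 < e\<close> by (simp add: zero_le_mult_iff)
      have "\<bar>f n / g n - 1\<bar> = \<bar>f n - g n\<bar> / g n" using g by (simp add: field_simps abs_divide)
      also have "\<dots> \<le> e / 2" using elim g by (simp add: field_simps)
      also have "\<dots> < e" using \<open>0 < e\<close> by simp
      finally show ?thesis using False by (simp add: dist_real_def)
    qed
  qed
qed

lemma sum_split:
  fixes f :: "nat \<Rightarrow> real" and k0 :: nat
  assumes "k0 \<le> L" "L \<le> m"
  shows "(\<Sum>k = k0..m. f k) = (\<Sum>k = k0..L. f k) + (\<Sum>k\<in>{L<..m}. f k)"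
proof -
  have *: "{k0..m} = {k0..L} \<union> {L<..m}" using assms by auto
  show ?thesis unfolding * by (rule sum.union_disjoint) auto
qed

context flat_boundary
begin

text \<open>Cuts the index range at \<open>L = \<lfloor>\<epsilon>n\<rfloor>\<close>. Up to \<open>L\<close> the curve has slope at most \<open>\<delta>\<close>; beyond \<open>L\<close> the
  hits are negligible, even after multiplication by \<open>n + 1\<close> or by the bound \<open>B\<close> of the correction
  term. The bound \<open>B\<close> depends on \<open>\<epsilon>\<close>, so the division by \<open>B + 1\<close> has to happen inside this
  statement.\<close>
lemma small_large_split:
  assumes "0 < \<delta>" "0 < e" and k0: "1 \<le> k0" and \<beta>: "0 < \<beta>" "\<beta> < 1"
    and K: "\<And>n. \<beta> * real n - 1 \<le> real (K n)" "\<And>n. real (K n) \<le> \<beta> * real n + 1"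
  obtains \<epsilon> B where "0 < \<epsilon>" "\<epsilon> < 1" "\<And>x. 0 < x \<Longrightarrow> x \<le> \<epsilon> \<Longrightarrow> D x \<le> \<delta>" "0 \<le> B"
    "\<forall>\<^sub>F n in sequentially. \<exists>L. k0 \<le> L \<and> L \<le> K n \<and> K n < n \<and> real L \<le> \<epsilon> * real n \<and>
       (\<forall>k\<in>{L<..K n}. D (real k / real n) / (1 - C (real k / real n)) \<le> B) \<and>
       (real n + 1) * (\<Sum>k\<in>{L<..K n}. hit_prob n k) \<le> e / (B + 1) * hit_prob n k0"
proof -
  \<comment> \<open>Rounding may push \<open>K n\<close> above \<open>\<beta>n\<close>, so compactness is used on an interval reaching beyond \<open>\<beta>\<close>.\<close>
  define b where "b = (1 + \<beta>) / 2"
  have b: "\<beta> < b" "b < 1" using \<beta> by (auto simp: b_def)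
  obtain \<epsilon> where \<epsilon>: "0 < \<epsilon>" "\<epsilon> < \<beta>" "\<forall>x. 0 < x \<and> x \<le> \<epsilon> \<longrightarrow> D x \<le> \<delta>"
    using flat_near_0[OF \<open>0 < \<delta>\<close> \<open>0 < \<beta>\<close>] by blast
  have \<epsilon>b: "\<epsilon> \<le> b" using \<epsilon> b by simp
  obtain B where B: "0 \<le> B" "\<And>x. \<epsilon> \<le> x \<Longrightarrow> x \<le> b \<Longrightarrow> D x / (1 - C x) \<le> B"
    using slope_ratio_bounded[OF \<epsilon>(1) \<epsilon>b b(2)] by blast
  define \<eta> where "\<eta> = e / (B + 1)"
  have \<eta>: "0 < \<eta>" using B(1) \<open>0 < e\<close> by (simp add: \<eta>_def)
  have "\<forall>\<^sub>F n in sequentially. real k0 + 1 \<le> \<epsilon> * real n"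
    using \<epsilon>(1) by real_asymp
  moreover have "\<forall>\<^sub>F n in sequentially. \<epsilon> * real n \<le> \<beta> * real n - 1"
    using \<epsilon>(2) by real_asymp
  moreover have "\<forall>\<^sub>F n in sequentially. \<beta> * real n + 1 \<le> b * real n"
    using b(1) by real_asymp
  moreover note macroscopic_hits_negligible[OF k0 \<epsilon>(1) \<epsilon>b b(2) \<eta>] eventually_gt_at_top[of 0]
  ultimately have "\<forall>\<^sub>F n in sequentially. \<exists>L. k0 \<le> L \<and> L \<le> K n \<and> K n < n \<and> real L \<le> \<epsilon> * real n \<and>
       (\<forall>k\<in>{L<..K n}. D (real k / real n) / (1 - C (real k / real n)) \<le> B) \<and>
       (real n + 1) * (\<Sum>k\<in>{L<..K n}. hit_prob n k) \<le> \<eta> * hit_prob n k0"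
  proof eventually_elim
    case (elim n)
    define L where "L = nat \<lfloor>\<epsilon> * real n\<rfloor>"
    have L: "real L \<le> \<epsilon> * real n" "\<epsilon> * real n < real L + 1"
      using \<epsilon>(1) by (auto simp: L_def)
    have "real k0 \<le> real L" "real L \<le> real (K n)" "real (K n) \<le> b * real n" "b * real n < 1 * real n"
      using L elim K[of n] b by (auto simp: mult_strict_right_mono)
    then have ord: "k0 \<le> L" "L \<le> K n" "K n < n" "real (K n) \<le> b * real n"
      by auto
    have large: "\<epsilon> * real n \<le> real k" "real k \<le> b * real n" if "k \<in> {L<..K n}" for k
    proof -
      have "real L + 1 \<le> real k" "real k \<le> real (K n)" using that by auto
      then show "\<epsilon> * real n \<le> real k" "real k \<le> b * real n" using L(2) ord(4) by auto
    qed
    have h0: "0 \<le> hit_prob n k0" using hit_prob_nonneg[of k0 n] k0 ord by auto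
    have "(real n + 1) * (\<Sum>k\<in>{L<..K n}. hit_prob n k) \<le> (\<Sum>k\<in>{L<..K n}. \<eta> * hit_prob n k0 / (real n + 1))"
      unfolding sum_distrib_left
    proof (rule sum_mono)
      fix k assume "k \<in> {L<..K n}"
      then have "(real n + 1)\<^sup>2 * hit_prob n k \<le> \<eta> * hit_prob n k0"
        using elim large by blast
      then show "(real n + 1) * hit_prob n k \<le> \<eta> * hit_prob n k0 / (real n + 1)"
        by (simp add: field_simps power2_eq_square)
    qed
    also have "\<dots> = real (K n - L) / (real n + 1) * (\<eta> * hit_prob n k0)" by simp
    also have "\<dots> \<le> 1 * (\<eta> * hit_prob n k0)"
      using ord h0 \<eta> by (intro mult_right_mono) (auto simp: field_simps)
    finally have "(real n + 1) * (\<Sum>k\<in>{L<..K n}. hit_prob n k) \<le> \<eta> * hit_prob n k0" by simp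
    moreover have "\<forall>k\<in>{L<..K n}. D (real k / real n) / (1 - C (real k / real n)) \<le> B"
      using large elim by (intro ballI B(2)) (auto simp: field_simps)
    ultimately show ?case using ord L(1) by blast
  qed
  then show ?thesis
    using that[of \<epsilon> B] \<epsilon> \<beta> B(1) unfolding \<eta>_def by auto
qed

lemma near_boundary:
  assumes "1 \<le> k" "k \<le> L" "L < n" "real L \<le> \<epsilon> * real n" "\<epsilon> < 1" "0 < \<delta>"
    and "\<And>x. 0 < x \<Longrightarrow> x \<le> \<epsilon> \<Longrightarrow> D x \<le> \<delta>"
  shows "D (real k / real n) \<le> \<delta>" "C (real k / real n) \<le> \<delta> * (real k / real n)"
    "real k / real n \<le> \<epsilon>"
proof -
  have "real k \<le> \<epsilon> * real n" using assms by (meson of_nat_mono order_trans)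
  then show "real k / real n \<le> \<epsilon>" using assms by (simp add: field_simps)
  moreover have "0 < real k / real n" using assms by simp
  ultimately show "D (real k / real n) \<le> \<delta>" "C (real k / real n) \<le> \<delta> * (real k / real n)"
    using assms C_le_linear[of "real k / real n" \<epsilon> \<delta>] by blast+
qed

context
  fixes k0 :: nat and \<beta> :: real and K :: "nat \<Rightarrow> nat"
  assumes k0: "1 \<le> k0" and \<beta>: "0 < \<beta>" "\<beta> < 1"
    and K: "\<And>n. \<beta> * real n - 1 \<le> real (K n)" "\<And>n. real (K n) \<le> \<beta> * real n + 1"
begin

text \<open>The correction is at most \<open>2\<delta>\<close> on small indices, where the curve is flat, and at most \<open>B\<close> on the
  others, whose total mass is negligible.\<close>
lemma correction_negligible:
  "(\<lambda>n. \<Sum>k = k0..K n. (1 - (real n - real k + 1) * D (real k / real n) / (real n * (1 - C (real k / real n))))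
        * hit_prob n k)
   \<sim>[sequentially] (\<lambda>n. \<Sum>k = k0..K n. hit_prob n k)"
proof (rule asymp_equiv_of_relative_error)
  fix e :: real assume "0 < e"
  define \<delta> where "\<delta> = min (1 / 2) (e / 4)"
  have \<delta>: "0 < \<delta>" "\<delta> \<le> 1 / 2" "2 * \<delta> \<le> e / 2" using \<open>0 < e\<close> by (auto simp: \<delta>_def)
  obtain \<epsilon> B where \<epsilon>: "0 < \<epsilon>" "\<epsilon> < 1" "\<And>x. 0 < x \<Longrightarrow> x \<le> \<epsilon> \<Longrightarrow> D x \<le> \<delta>" and "0 \<le> B"
    and ev: "\<forall>\<^sub>F n in sequentially. \<exists>L. k0 \<le> L \<and> L \<le> K n \<and> K n < n \<and> real L \<le> \<epsilon> * real n \<and>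
       (\<forall>k\<in>{L<..K n}. D (real k / real n) / (1 - C (real k / real n)) \<le> B) \<and>
       (real n + 1) * (\<Sum>k\<in>{L<..K n}. hit_prob n k) \<le> e / 2 / (B + 1) * hit_prob n k0"
    using small_large_split[OF \<delta>(1) _ k0 \<beta> K, of "e / 2"] \<open>0 < e\<close> by auto
  from ev show "\<forall>\<^sub>F n in sequentially.
     \<bar>(\<Sum>k = k0..K n. (1 - (real n - real k + 1) * D (real k / real n) / (real n * (1 - C (real k / real n))))
        * hit_prob n k) - (\<Sum>k = k0..K n. hit_prob n k)\<bar> \<le> e * (\<Sum>k = k0..K n. hit_prob n k)"
  proof eventually_elim
    case (elim n)
    then obtain L where L: "k0 \<le> L" "L \<le> K n" "K n < n" "real L \<le> \<epsilon> * real n"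
      and big: "\<And>k. k \<in> {L<..K n} \<Longrightarrow> D (real k / real n) / (1 - C (real k / real n)) \<le> B"
      and tail: "(real n + 1) * (\<Sum>k\<in>{L<..K n}. hit_prob n k) \<le> e / 2 / (B + 1) * hit_prob n k0"
      by blast
    define a where "a k = D (real k / real n) / (1 - C (real k / real n))" for k
    define S1 where "S1 = (\<Sum>k = k0..L. hit_prob n k)"
    define S2 where "S2 = (\<Sum>k\<in>{L<..K n}. hit_prob n k)"
    have h: "0 \<le> hit_prob n k" if "k0 \<le> k" "k \<le> K n" for k
      using that k0 L by (intro hit_prob_nonneg) auto
    have S: "(\<Sum>k = k0..K n. hit_prob n k) = S1 + S2"
      unfolding S1_def S2_def using L by (intro sum_split) auto
    have S2: "0 \<le> S2" unfolding S2_def using L by (intro sum_nonneg h) auto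
    have h0: "hit_prob n k0 \<le> S1"
      unfolding S1_def using L h by (intro member_le_sum) auto
    have a: "0 \<le> a k" if "k0 \<le> k" "k \<le> K n" for k
    proof -
      have "1 \<le> k" "k < n" using that L k0 by auto
      then show ?thesis
        unfolding a_def using D_nonneg[of "real k / real n"] C_frac_range[of k n] frac_range[of k n]
        by auto
    qed
    have a1: "a k \<le> 2 * \<delta>" if "k \<in> {k0..L}" for k
    proof -
      have k: "1 \<le> k" "k \<le> L" "L < n" using that k0 L by auto
      note nb = near_boundary[OF k L(4) \<epsilon>(2) \<delta>(1) \<epsilon>(3)]
      have "\<delta> * (real k / real n) \<le> 1 / 2 * 1"
        using \<delta> k by (intro mult_mono) auto
      then have "1 / 2 \<le> 1 - C (real k / real n)" using nb(2) by linarith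
      then have "D (real k / real n) / (1 - C (real k / real n)) \<le> \<delta> / (1 / 2)"
        using nb(1) \<delta> by (intro frac_le) auto
      then show ?thesis by (simp add: a_def)
    qed
    have "(\<Sum>k = k0..K n. (1 - (real n - real k + 1) * D (real k / real n) / (real n * (1 - C (real k / real n))))
        * hit_prob n k) - (\<Sum>k = k0..K n. hit_prob n k)
      = - (\<Sum>k = k0..K n. (real n - real k + 1) / real n * a k * hit_prob n k)"
      unfolding sum_subtractf[symmetric] sum_negf[symmetric]
      by (intro sum.cong refl) (simp add: a_def left_diff_distrib)
    then have "\<bar>(\<Sum>k = k0..K n. (1 - (real n - real k + 1) * D (real k / real n) / (real n * (1 - C (real k / real n))))
        * hit_prob n k) - (\<Sum>k = k0..K n. hit_prob n k)\<bar>
      = \<bar>\<Sum>k = k0..K n. (real n - real k + 1) / real n * a k * hit_prob n k\<bar>"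
      by (simp only: abs_minus)
    also have "\<dots> \<le> (\<Sum>k = k0..K n. \<bar>(real n - real k + 1) / real n * a k * hit_prob n k\<bar>)"
      by (rule sum_abs)
    also have "\<dots> \<le> (\<Sum>k = k0..K n. a k * hit_prob n k)"
    proof (rule sum_mono)
      fix k assume k: "k \<in> {k0..K n}"
      then have w: "0 \<le> (real n - real k + 1) / real n" "(real n - real k + 1) / real n \<le> 1"
        using k0 L by auto
      have v: "0 \<le> a k * hit_prob n k" using k a h by auto
      have "0 \<le> (real n - real k + 1) / real n * (a k * hit_prob n k)"
        using w(1) v by (rule mult_nonneg_nonneg)
      moreover have "(real n - real k + 1) / real n * (a k * hit_prob n k) \<le> a k * hit_prob n k"
        using mult_right_mono[OF w(2) v] by (simp only: mult_1)
      ultimately show "\<bar>(real n - real k + 1) / real n * a k * hit_prob n k\<bar> \<le> a k * hit_prob n k"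
        by (simp only: mult.assoc abs_of_nonneg)
    qed
    also have "\<dots> = (\<Sum>k = k0..L. a k * hit_prob n k) + (\<Sum>k\<in>{L<..K n}. a k * hit_prob n k)"
      using L by (intro sum_split) auto
    also have "\<dots> \<le> (\<Sum>k = k0..L. 2 * \<delta> * hit_prob n k) + (\<Sum>k\<in>{L<..K n}. B * hit_prob n k)"
      using a1 h L big unfolding a_def by (intro add_mono sum_mono mult_right_mono) auto
    also have "\<dots> = 2 * \<delta> * S1 + B * S2"
      by (simp add: S1_def S2_def sum_distrib_left)
    also have "B * S2 \<le> e / 2 * S1"
    proof -
      have "1 * S2 \<le> (real n + 1) * S2" using S2 by (intro mult_right_mono) auto
      then have "S2 \<le> e / 2 / (B + 1) * hit_prob n k0" using tail by (simp add: S2_def)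
      then have "(B + 1) * S2 \<le> e / 2 * hit_prob n k0" using \<open>0 \<le> B\<close> by (simp add: field_simps)
      also have "\<dots> \<le> e / 2 * S1" using h0 \<open>0 < e\<close> by (intro mult_left_mono) auto
      finally show ?thesis using S2 by (simp add: algebra_simps)
    qed
    also have "2 * \<delta> * S1 + e / 2 * S1 \<le> e * (S1 + S2)"
    proof -
      have "0 \<le> S1" unfolding S1_def using L by (intro sum_nonneg h) auto
      then have "2 * \<delta> * S1 \<le> e / 2 * S1" using \<delta> by (intro mult_right_mono) auto
      moreover have "0 \<le> e * S2" using S2 \<open>0 < e\<close> by simp
      ultimately show ?thesis by (simp add: algebra_simps)
    qed
    finally show ?case unfolding S by simp
  qed
qed

text \<open>Both bounds lose only a factor \<open>1 + O(\<delta>)\<close> on small indices. Beyond \<open>L\<close> the upper bound pays a factor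
  \<open>n + 1\<close> for replacing a tail by its first term, and the lower bound drops the indices
  altogether.\<close>
lemma hitting_prob_asymp:
  assumes sample: "\<And>n. uniform_sample (M n) n (X n)"
  shows "(\<lambda>n. measure (M n) (\<Union>k\<in>{k0..K n}. {\<omega> \<in> space (M n).
             k \<le> card (uniform_sample.below n (X n) (C (real k / real n)) \<omega>)}))
   \<sim>[sequentially] (\<lambda>n. \<Sum>k = k0..K n. hit_prob n k)"
proof (rule asymp_equiv_of_relative_error)
  fix e :: real assume "0 < e"
  define \<delta> where "\<delta> = min (1 / 12) (e / 24)"
  have \<delta>: "0 < \<delta>" "\<delta> \<le> 1 / 12" "12 * \<delta> \<le> e / 2" using \<open>0 < e\<close> by (auto simp: \<delta>_def)
  \<comment> \<open>Linear bounds for the two geometric series with ratio \<open>6\<delta> \<le> 1/2\<close>.\<close>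
  have q: "1 / (1 - 6 * \<delta>) \<le> 1 + 12 * \<delta>" "1 - 12 * \<delta> \<le> 1 - 6 * \<delta> / (1 - 6 * \<delta>)"
  proof -
    have "1 \<le> (1 + 12 * \<delta>) * (1 - 6 * \<delta>)" using \<delta> mult_mono[of \<delta> "1/12" \<delta> \<delta>] by (simp add: algebra_simps)
    then show "1 / (1 - 6 * \<delta>) \<le> 1 + 12 * \<delta>" using \<delta> by (simp add: field_simps)
    moreover have "6 * \<delta> / (1 - 6 * \<delta>) = 1 / (1 - 6 * \<delta>) - 1" using \<delta> by (simp add: field_simps)
    ultimately show "1 - 12 * \<delta> \<le> 1 - 6 * \<delta> / (1 - 6 * \<delta>)" by simp
  qed
  obtain \<epsilon> B where \<epsilon>: "0 < \<epsilon>" "\<epsilon> < 1" "\<And>x. 0 < x \<Longrightarrow> x \<le> \<epsilon> \<Longrightarrow> D x \<le> \<delta>" and "0 \<le> B"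
    and ev: "\<forall>\<^sub>F n in sequentially. \<exists>L. k0 \<le> L \<and> L \<le> K n \<and> K n < n \<and> real L \<le> \<epsilon> * real n \<and>
       (\<forall>k\<in>{L<..K n}. D (real k / real n) / (1 - C (real k / real n)) \<le> B) \<and>
       (real n + 1) * (\<Sum>k\<in>{L<..K n}. hit_prob n k) \<le> e / 2 / (B + 1) * hit_prob n k0"
    using small_large_split[OF \<delta>(1) _ k0 \<beta> K, of "e / 2"] \<open>0 < e\<close> by auto
  from ev show "\<forall>\<^sub>F n in sequentially.
     \<bar>measure (M n) (\<Union>k\<in>{k0..K n}. {\<omega> \<in> space (M n).
             k \<le> card (uniform_sample.below n (X n) (C (real k / real n)) \<omega>)})
        - (\<Sum>k = k0..K n. hit_prob n k)\<bar> \<le> e * (\<Sum>k = k0..K n. hit_prob n k)"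
  proof eventually_elim
    case (elim n)
    then obtain L where L: "k0 \<le> L" "L \<le> K n" "K n < n" "real L \<le> \<epsilon> * real n"
      and tail: "(real n + 1) * (\<Sum>k\<in>{L<..K n}. hit_prob n k) \<le> e / 2 / (B + 1) * hit_prob n k0"
      by blast
    interpret uniform_sample "M n" n "X n" by (rule sample)
    define c where "c k = C (real k / real n)" for k
    define A where "A k = {\<omega> \<in> space (M n). k \<le> card (below (c k) \<omega>)}" for k
    define P where "P = measure (M n) (\<Union>k\<in>{k0..K n}. A k)"
    define S1 where "S1 = (\<Sum>k = k0..L. hit_prob n k)"
    define S2 where "S2 = (\<Sum>k\<in>{L<..K n}. hit_prob n k)"
    have A: "A k \<in> events" for k
      unfolding A_def by (rule below_pred_in_events)
    have kn: "1 \<le> k" "k < n" if "k0 \<le> k" "k \<le> K n" for k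
      using that k0 L by auto
    have h: "0 \<le> hit_prob n k" if "k0 \<le> k" "k \<le> K n" for k
      using kn[OF that] by (intro hit_prob_nonneg) auto
    have S: "(\<Sum>k = k0..K n. hit_prob n k) = S1 + S2"
      unfolding S1_def S2_def using L by (intro sum_split) auto
    have S2: "0 \<le> S2" unfolding S2_def using L by (intro sum_nonneg h) auto
    have S1: "0 \<le> S1" unfolding S1_def using L by (intro sum_nonneg h) auto
    have h0: "hit_prob n k0 \<le> S1"
      unfolding S1_def using L h by (intro member_le_sum) auto
    have tail': "(real n + 1) * S2 \<le> e / 2 * S1"
    proof -
      have "(real n + 1) * S2 \<le> e / 2 / (B + 1) * hit_prob n k0" using tail by (simp add: S2_def)
      also have "\<dots> \<le> e / 2 * S1"
        using h0 h[of k0] L \<open>0 < e\<close> \<open>0 \<le> B\<close> by (intro mult_mono) (auto simp: field_simps)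
      finally show ?thesis .
    qed
    have small: "0 \<le> c k" "c k \<le> 1 / 2" "real n * c k \<le> \<delta> * real k" "real k / real n \<le> \<epsilon>"
      if "k \<in> {k0..L}" for k
    proof -
      have k: "1 \<le> k" "k \<le> L" "L < n" using that k0 L by auto
      note nb = near_boundary[OF k L(4) \<epsilon>(2) \<delta>(1) \<epsilon>(3)]
      have "\<delta> * (real k / real n) \<le> 1 / 12 * 1"
        using \<delta> k by (intro mult_mono) auto
      then show "c k \<le> 1 / 2" using nb(2) unfolding c_def by linarith
      show "real k / real n \<le> \<epsilon>" by (rule nb(3))
      show "0 \<le> c k" using C_frac_range[of k n] k by (simp add: c_def)
      show "real n * c k \<le> \<delta> * real k" using nb(2) k by (simp add: c_def field_simps)
    qed

    have "P \<le> (\<Sum>k = k0..K n. measure (M n) (A k))"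
      unfolding P_def by (intro finite_measure_subadditive_finite image_subsetI A) simp
    also have "\<dots> = (\<Sum>k = k0..L. measure (M n) (A k)) + (\<Sum>k\<in>{L<..K n}. measure (M n) (A k))"
      using L by (intro sum_split) auto
    also have "\<dots> \<le> (\<Sum>k = k0..L. hit_prob n k / (1 - 6 * \<delta>)) + (\<Sum>k\<in>{L<..K n}. (real n + 1) * hit_prob n k)"
    proof (intro add_mono sum_mono)
      fix k assume k: "k \<in> {k0..L}"
      have "2 * (real n * c k) \<le> 6 * \<delta> * real k"
        using small(3)[OF k] mult_nonneg_nonneg[of \<delta> "real k"] \<delta> by linarith
      then show "measure (M n) (A k) \<le> hit_prob n k / (1 - 6 * \<delta>)"
        unfolding A_def c_def[symmetric]
        using small[OF k] \<delta> k L by (intro prob_below_ge_le_of_small_mean) auto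
    next
      fix k assume "k \<in> {L<..K n}"
      then have k: "1 \<le> k" "k < n" using kn[of k] L by auto
      have "c k < real k / real n" using C_less[OF frac_range[OF k]] by (simp add: c_def)
      then have "real n * c k \<le> real k" using k by (simp add: field_simps)
      then show "measure (M n) (A k) \<le> (real n + 1) * hit_prob n k"
        unfolding A_def c_def[symmetric]
        using C_frac_range[OF k] k by (intro prob_below_ge_le_of_mean_le) (auto simp: c_def)
    qed
    also have "\<dots> = 1 / (1 - 6 * \<delta>) * S1 + (real n + 1) * S2"
      by (simp add: S1_def S2_def sum_distrib_left sum_divide_distrib)
    also have "\<dots> \<le> (1 + 12 * \<delta>) * S1 + e / 2 * S1"
      using q S1 tail' by (intro add_mono mult_right_mono) auto
    also have "\<dots> \<le> (1 + e / 2) * S1 + e / 2 * S1"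
      using \<delta> S1 by (intro add_mono mult_right_mono) auto
    finally have upper: "P \<le> S1 + e * S1" by (simp add: algebra_simps)

    have "(1 - 12 * \<delta>) * S1 \<le> (1 - 6 * \<delta> / (1 - 6 * \<delta>)) * S1"
      using q S1 by (intro mult_right_mono) auto
    also have "\<dots> \<le> measure (M n) (\<Union>k\<in>{k0..L}. A k)"
      unfolding S1_def A_def c_def[symmetric]
    proof (rule prob_hit_ge)
      show "L \<le> n" using L by auto
      show "0 \<le> c k \<and> c k \<le> 1 / 2" if "k0 \<le> k" "k \<le> L" for k using small[of k] that by auto
      have incr: "c k \<le> c l \<and> c l - c k \<le> \<delta> * (real l / real n - real k / real n)"
        if "k0 \<le> k" "k < l" "l \<le> L" for k l
      proof -
        have "0 < real k / real n" "real k / real n < real l / real n"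
          using that k0 L by (auto simp: divide_strict_right_mono)
        then show ?thesis
          using C_increment[of "real k / real n" "real l / real n" \<epsilon> \<delta>] small(4)[of l] that \<epsilon>
          unfolding c_def by auto
      qed
      show "c k \<le> c l" if "k0 \<le> k" "k < l" "l \<le> L" for k l using incr[OF that] by simp
      show "real n * (c l - c k) \<le> \<delta> * real (l - k)" if "k0 \<le> k" "k < l" "l \<le> L" for k l
      proof -
        have "real n * (c l - c k) \<le> real n * (\<delta> * (real l / real n - real k / real n))"
          using incr[OF that] by (intro mult_left_mono) auto
        also have "\<dots> = \<delta> * real (l - k)" using that L by (simp add: field_simps of_nat_diff)
        finally show ?thesis .
      qed
    qed (use \<delta> in auto)
    also have "\<dots> \<le> P"
      unfolding P_def using L by (intro finite_measure_mono UN_mono sets.finite_UN A) auto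
    finally have "(1 - 12 * \<delta>) * S1 \<le> P" .
    moreover have "12 * \<delta> * S1 \<le> e / 2 * S1" using \<delta> S1 by (intro mult_right_mono) auto
    moreover have "S2 \<le> e / 2 * S1"
      using tail' S2 mult_right_mono[of 1 "real n + 1" S2] by simp
    ultimately have lower: "S1 + S2 - e * S1 \<le> P" by (simp add: algebra_simps)

    have "0 \<le> e * S2" using S2 \<open>0 < e\<close> by simp
    then have "\<bar>P - (S1 + S2)\<bar> \<le> e * (S1 + S2)"
      using upper lower S2 by (simp add: abs_le_iff algebra_simps)
    then show ?case unfolding S P_def A_def c_def .
  qed
qed

end

end

section \<open>The two boundary curves\<close>

lemma deriv_of_local_inverse:
  fixes g w :: "real \<Rightarrow> real"
  assumes "(g has_real_derivative d) (at y)" "d \<noteq> 0"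
    and left: "\<forall>\<^sub>F z in nhds y. w (g z) = z"
    and right: "\<forall>\<^sub>F x in nhds (g y). g (w x) = x"
    and cont: "\<forall>\<^sub>F z in nhds y. isCont g z"
  shows "(w has_real_derivative inverse d) (at (g y))"
proof -
  have wy: "w (g y) = y" using eventually_nhds_x_imp_x[OF left] .
  from eventually_conj[OF left cont] obtain e where e: "e > 0"
    "\<And>z. dist z y < e \<Longrightarrow> w (g z) = z \<and> isCont g z"
    unfolding eventually_nhds_metric by blast
  have "isCont w (g y)"
    by (rule isCont_inverse_function2[where a = "y - e / 2" and x = y and b = "y + e / 2" and f = g and g = w])
       (use e in \<open>auto simp: dist_real_def\<close>)
  from right obtain r where r: "r > 0" "\<And>x. dist x (g y) < r \<Longrightarrow> g (w x) = x"
    unfolding eventually_nhds_metric by blast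
  show ?thesis
    by (rule DERIV_inverse_function[where f = g and g = w and x = "g y" and D = d and a = "g y - r" and b = "g y + r"])
       (use assms wy r \<open>isCont w (g y)\<close> in \<open>auto simp: dist_real_def\<close>)
qed

lemma boundary_props:
  assumes "i = 1 \<or> i = 2" "0 < x" "x < 1" "0 < \<xi>"
  shows "0 < boundary i x \<xi>" "boundary i x \<xi> < x" "gof i x (boundary i x \<xi>) = \<xi> ^ i"
  using theI'[OF boundary_ex1[of i x \<xi>]] assms by (auto simp: boundary_def)

lemma boundary_eqI:
  assumes "i = 1 \<or> i = 2" "x < 1" "0 < \<xi>" "0 < y" "y < x" "gof i x y = \<xi> ^ i"
  shows "boundary i x \<xi> = y"
  unfolding boundary_def by (rule the1_equality[OF boundary_ex1]) (use assms in auto)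

lemma boundary_tendsto_0:
  assumes "i = 1 \<or> i = 2" "0 < \<xi>"
  shows "((\<lambda>x. boundary i x \<xi>) \<longlongrightarrow> 0) (at_right 0)"
proof (rule tendsto_sandwich)
  have ev: "\<forall>\<^sub>F x in at_right (0::real). 0 < x \<and> x < 1"
    by (intro eventually_at_rightI[of 0 1]) auto
  show "\<forall>\<^sub>F x in at_right 0. 0 \<le> boundary i x \<xi>" "\<forall>\<^sub>F x in at_right 0. boundary i x \<xi> \<le> x"
    using ev by (eventually_elim; use boundary_props assms in \<open>auto intro: less_imp_le\<close>)+
qed (auto intro: tendsto_ident_at)

text \<open>Solving \<open>f1 x y = \<xi>\<close> for \<open>x\<close>: the curve for \<open>i = 1\<close> is an inverse of this function.\<close>
definition hc_level :: "real \<Rightarrow> real \<Rightarrow> real" where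
  "hc_level \<xi> y = y + \<xi> * sqrt (y * (1 - y))"

definition hc_level_deriv :: "real \<Rightarrow> real \<Rightarrow> real" where
  "hc_level_deriv \<xi> y = 1 + \<xi> * (1 - 2 * y) / (2 * sqrt (y * (1 - y)))"

lemma hc_level_has_deriv:
  "0 < y \<Longrightarrow> y < 1 \<Longrightarrow> (hc_level \<xi> has_real_derivative hc_level_deriv \<xi> y) (at y)"
  unfolding hc_level_def hc_level_deriv_def
  by (auto intro!: derivative_eq_intros simp: field_simps)

lemma f1_eq_iff: "0 < y \<Longrightarrow> y < 1 \<Longrightarrow> f1 x y = \<xi> \<longleftrightarrow> hc_level \<xi> y = x"
  by (auto simp: f1_def hc_level_def field_simps)

text \<open>The level function increases wherever its value stays below \<open>1\<close>. Only \<open>y > 1/2\<close> needs work: there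
  \<open>\<xi>\<close> is smaller than \<open>(1 - y) / (y(1 - y))\<^sup>1\<^sup>/\<^sup>2\<close>, which makes the negative part of the derivative at most
  \<open>(2y - 1) / (2y) < 1\<close>.\<close>
lemma hc_level_deriv_pos:
  assumes "0 < \<xi>" "0 < y" "y < 1" "hc_level \<xi> y < 1"
  shows "0 < hc_level_deriv \<xi> y"
proof (cases "y \<le> 1 / 2")
  case True
  then have "0 \<le> \<xi> * (1 - 2 * y) / (2 * sqrt (y * (1 - y)))"
    using assms by (intro divide_nonneg_nonneg mult_nonneg_nonneg) auto
  then show ?thesis by (simp add: hc_level_deriv_def)
next
  case False
  define s where "s = sqrt (y * (1 - y))"
  have s: "0 < s" "s * s = y * (1 - y)" using assms by (auto simp: s_def)
  have "\<xi> * s < 1 - y" using assms by (simp add: hc_level_def s_def)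
  then have "\<xi> * s * (2 * y - 1) < (1 - y) * (2 * y - 1)"
    using False by (intro mult_strict_right_mono) auto
  also have "\<dots> < (1 - y) * (2 * y)" using assms by (intro mult_strict_left_mono) auto
  also have "\<dots> = s * (2 * s)" using s by (simp add: algebra_simps)
  finally have "s * (\<xi> * (2 * y - 1)) < s * (2 * s)" by (simp add: algebra_simps)
  then have "\<xi> * (2 * y - 1) < 2 * s" using s by simp
  then have "\<xi> * (2 * y - 1) / (2 * s) < 1" using s by simp
  moreover have "\<xi> * (1 - 2 * y) / (2 * s) = - (\<xi> * (2 * y - 1) / (2 * s))"
    by (simp add: algebra_simps divide_simps)
  ultimately show ?thesis
    unfolding hc_level_deriv_def s_def[symmetric] by simp
qed

lemma boundary1_has_deriv:
  assumes \<xi>: "0 < \<xi>" and x: "0 < x" "x < 1"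
  shows "((\<lambda>x. boundary 1 x \<xi>) has_real_derivative inverse (hc_level_deriv \<xi> (boundary 1 x \<xi>))) (at x)"
proof -
  define y where "y = boundary 1 x \<xi>"
  have y: "0 < y" "y < 1" using boundary_props[of 1 x \<xi>] assms by (auto simp: y_def)
  have lev: "hc_level \<xi> (boundary 1 z \<xi>) = z" if "0 < z" "z < 1" for z
    using boundary_props[of 1 z \<xi>] that \<xi> by (auto simp: gof_def f1_eq_iff)
  have gy: "hc_level \<xi> y = x" using lev x by (simp add: y_def)
  have "((\<lambda>x. boundary 1 x \<xi>) has_real_derivative inverse (hc_level_deriv \<xi> y)) (at (hc_level \<xi> y))"
  proof (rule deriv_of_local_inverse[where g = "hc_level \<xi>" and y = y])
    show "(hc_level \<xi> has_real_derivative hc_level_deriv \<xi> y) (at y)"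
      using y by (rule hc_level_has_deriv)
    show "hc_level_deriv \<xi> y \<noteq> 0"
      using hc_level_deriv_pos[of \<xi> y] y \<xi> x gy by simp
    have ev: "\<forall>\<^sub>F z in nhds y. 0 < z \<and> z < 1"
      using y eventually_nhds_in_open[of "{0<..<1}" y] by simp
    then show "\<forall>\<^sub>F z in nhds y. isCont (hc_level \<xi>) z"
      by eventually_elim (auto intro: DERIV_isCont hc_level_has_deriv)
    have "\<forall>\<^sub>F z in nhds y. hc_level \<xi> z \<in> {..<1}"
    proof (rule topological_tendstoD)
      show "(hc_level \<xi> \<longlongrightarrow> hc_level \<xi> y) (nhds y)"
        using DERIV_isCont[OF hc_level_has_deriv[OF y]] by (simp add: isCont_def tendsto_at_iff_tendsto_nhds)
    qed (use gy x in auto)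
    with ev show "\<forall>\<^sub>F z in nhds y. boundary 1 (hc_level \<xi> z) \<xi> = z"
    proof eventually_elim
      case (elim z)
      have "z < hc_level \<xi> z" using elim \<xi> by (simp add: hc_level_def)
      then show ?case
        using elim \<xi> by (intro boundary_eqI) (auto simp: gof_def f1_eq_iff)
    qed
    show "\<forall>\<^sub>F x in nhds (hc_level \<xi> y). hc_level \<xi> (boundary 1 x \<xi>) = x"
      unfolding gy using x eventually_nhds_in_open[of "{0<..<1}" x]
      by (auto elim!: eventually_mono intro: lev simp del: One_nat_def)
  qed
  then show ?thesis unfolding gy unfolding y_def .
qed

text \<open>The curve for \<open>i = 1\<close> is at least a multiple of \<open>x\<^sup>2\<close>, so its logarithm is too small to matter after
  multiplication by \<open>x\<close>.\<close>
lemma boundary1_rate: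
  assumes \<xi>: "0 < \<xi>"
  shows "((\<lambda>x. x * ln (1 / boundary 1 x \<xi>)) \<longlongrightarrow> 0) (at_right 0)"
proof (rule tendsto_sandwich)
  have ev: "\<forall>\<^sub>F x in at_right (0::real). 0 < x \<and> x < 1"
    by (intro eventually_at_rightI[of 0 1]) auto
  show "\<forall>\<^sub>F x in at_right 0. 0 \<le> x * ln (1 / boundary 1 x \<xi>)"
    using ev
  proof eventually_elim
    case (elim x)
    then show ?case
      using boundary_props[of 1 x \<xi>] \<xi> by (intro mult_nonneg_nonneg ln_ge_zero) auto
  qed
  show "\<forall>\<^sub>F x in at_right 0. x * ln (1 / boundary 1 x \<xi>) \<le> x * ln ((1 + \<xi>)\<^sup>2 / x\<^sup>2)"
    using ev
  proof eventually_elim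
    case (elim x)
    define y where "y = boundary 1 x \<xi>"
    have y: "0 < y" "y < 1" "hc_level \<xi> y = x"
      using boundary_props[of 1 x \<xi>] elim \<xi> by (auto simp: y_def gof_def f1_eq_iff)
    have "y * y \<le> y" using y mult_left_le[of y y] by simp
    then have "y \<le> sqrt y" using y by (simp add: real_le_rsqrt power2_eq_square)
    moreover have "\<xi> * sqrt (y * (1 - y)) \<le> \<xi> * sqrt y"
      using y \<xi> by (intro mult_left_mono real_sqrt_le_mono) (auto simp: mult_left_le)
    ultimately have "x \<le> (1 + \<xi>) * sqrt y"
      using y(3) by (simp add: hc_level_def algebra_simps)
    then have "x\<^sup>2 \<le> ((1 + \<xi>) * sqrt y)\<^sup>2"
      using elim by (intro power_mono) auto
    also have "\<dots> = (1 + \<xi>)\<^sup>2 * y" using y by (simp add: power_mult_distrib)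
    finally have "1 / y \<le> (1 + \<xi>)\<^sup>2 / x\<^sup>2"
      using y elim by (simp add: field_simps)
    then show ?case
      unfolding y_def[symmetric] using y elim by (intro mult_left_mono ln_mono) auto
  qed
  show "((\<lambda>x. x * ln ((1 + \<xi>)\<^sup>2 / x\<^sup>2)) \<longlongrightarrow> 0) (at_right 0)"
    using \<xi> by real_asymp
qed auto

text \<open>In terms of the ratio \<open>r = x/y\<close>, the equation \<open>f2 x y = \<xi>\<^sup>2\<close> becomes linear in \<open>x\<close>.\<close>
lemma boundary2_props:
  assumes "0 < \<xi>" "0 < x" "x < 1"
  defines "r \<equiv> x / boundary 2 x \<xi>"
  shows "1 < r" "x * (ln r - 1 + 1 / r) = \<xi>\<^sup>2 / 2"
    "x * ln r - (x - boundary 2 x \<xi>) = \<xi>\<^sup>2 / 2"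
proof -
  note b = boundary_props[of 2 x \<xi>]
  show "1 < r" "x * ln r - (x - boundary 2 x \<xi>) = \<xi>\<^sup>2 / 2"
    using b assms by (auto simp: gof_def f2_def r_def)
  then show "x * (ln r - 1 + 1 / r) = \<xi>\<^sup>2 / 2"
    using b assms by (simp add: algebra_simps)
qed

definition bj_gap :: "real \<Rightarrow> real" where
  "bj_gap r = ln r - 1 + 1 / r"

lemma bj_gap_pos: "1 < r \<Longrightarrow> 0 < bj_gap r"
proof -
  assume r: "1 < r"
  have "ln (1 / r) < 1 / r - 1"
    using r ln_le_minus_one[of "1 / r"] ln_eq_minus_one[of "1 / r"] by fastforce
  then show ?thesis using r by (simp add: bj_gap_def ln_div)
qed

lemma bj_gap_has_deriv:
  "1 < r \<Longrightarrow> (bj_gap has_real_derivative (r - 1) / r\<^sup>2) (at r)"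
  unfolding bj_gap_def
  by (auto intro!: derivative_eq_intros simp: field_simps power2_eq_square)

text \<open>The value of \<open>x\<close> at which the curve for \<open>i = 2\<close> satisfies \<open>x / C(x) = r\<close>.\<close>
definition bj_level :: "real \<Rightarrow> real \<Rightarrow> real" where
  "bj_level \<xi> r = \<xi>\<^sup>2 / 2 / bj_gap r"

lemma bj_level_has_deriv:
  assumes "1 < r"
  shows "(bj_level \<xi> has_real_derivative - (\<xi>\<^sup>2 / 2 * ((r - 1) / r\<^sup>2)) / (bj_gap r)\<^sup>2) (at r)"
  using bj_gap_pos[OF assms] assms unfolding bj_level_def
  by (auto intro!: derivative_eq_intros bj_gap_has_deriv simp: field_simps power2_eq_square)

lemma boundary2_ratio_has_deriv:
  assumes \<xi>: "0 < \<xi>" and x: "0 < x" "x < 1"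
  defines "R \<equiv> (\<lambda>x. x / boundary 2 x \<xi>)"
  shows "(R has_real_derivative inverse (- (\<xi>\<^sup>2 / 2 * ((R x - 1) / (R x)\<^sup>2)) / (bj_gap (R x))\<^sup>2)) (at x)"
proof -
  have lev: "bj_level \<xi> (R z) = z" and R1: "1 < R z" if "0 < z" "z < 1" for z
    using boundary2_props[of \<xi> z] bj_gap_pos[of "R z"] that \<xi>
    by (auto simp: R_def bj_level_def bj_gap_def field_simps)
  have gy: "bj_level \<xi> (R x) = x" and r1: "1 < R x" using lev R1 x by auto
  have "(R has_real_derivative inverse (- (\<xi>\<^sup>2 / 2 * ((R x - 1) / (R x)\<^sup>2)) / (bj_gap (R x))\<^sup>2))
      (at (bj_level \<xi> (R x)))"
  proof (rule deriv_of_local_inverse[where g = "bj_level \<xi>" and y = "R x"])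
    show "(bj_level \<xi> has_real_derivative - (\<xi>\<^sup>2 / 2 * ((R x - 1) / (R x)\<^sup>2)) / (bj_gap (R x))\<^sup>2) (at (R x))"
      using r1 by (rule bj_level_has_deriv)
    show "- (\<xi>\<^sup>2 / 2 * ((R x - 1) / (R x)\<^sup>2)) / (bj_gap (R x))\<^sup>2 \<noteq> 0"
      using r1 \<xi> bj_gap_pos[OF r1] by simp
    have ev: "\<forall>\<^sub>F z in nhds (R x). 1 < z"
      using r1 eventually_nhds_in_open[of "{1<..}" "R x"] by simp
    then show "\<forall>\<^sub>F z in nhds (R x). isCont (bj_level \<xi>) z"
      by eventually_elim (auto intro: DERIV_isCont bj_level_has_deriv)
    have "\<forall>\<^sub>F z in nhds (R x). bj_level \<xi> z \<in> {..<1}"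
    proof (rule topological_tendstoD)
      show "(bj_level \<xi> \<longlongrightarrow> bj_level \<xi> (R x)) (nhds (R x))"
        using DERIV_isCont[OF bj_level_has_deriv[OF r1]] by (simp add: isCont_def tendsto_at_iff_tendsto_nhds)
    qed (use gy x in auto)
    with ev show "\<forall>\<^sub>F z in nhds (R x). R (bj_level \<xi> z) = z"
    proof eventually_elim
      case (elim r)
      define t where "t = bj_level \<xi> r"
      have t: "0 < t" "t < 1" "t * bj_gap r = \<xi>\<^sup>2 / 2"
        using elim \<xi> bj_gap_pos[of r] by (auto simp: t_def bj_level_def)
      have "boundary 2 t \<xi> = t / r"
      proof (rule boundary_eqI)
        show "gof 2 t (t / r) = \<xi>\<^sup>2"
          using t elim by (simp add: gof_def f2_def bj_gap_def algebra_simps)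
      qed (use t elim \<xi> in \<open>auto simp: field_simps\<close>)
      then show ?case using t elim by (simp add: R_def flip: t_def)
    qed
    show "\<forall>\<^sub>F x in nhds (bj_level \<xi> (R x)). bj_level \<xi> (R x) = x"
      unfolding gy using x eventually_nhds_in_open[of "{0<..<1}" x]
      by (auto elim!: eventually_mono intro: lev)
  qed
  then show ?thesis by (simp add: gy)
qed

lemma boundary2_has_deriv:
  assumes \<xi>: "0 < \<xi>" and x: "0 < x" "x < 1"
  defines "r \<equiv> x / boundary 2 x \<xi>"
  shows "((\<lambda>x. boundary 2 x \<xi>) has_real_derivative ln r / (r - 1)) (at x)"
proof -
  define R where "R = (\<lambda>x. x / boundary 2 x \<xi>)"
  define g where "g = bj_gap r"
  have r: "1 < r" "x * g = \<xi>\<^sup>2 / 2"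
    using boundary2_props[of \<xi> x] assms by (auto simp: g_def bj_gap_def)
  have g: "0 < g" using bj_gap_pos r by (simp add: g_def)
  have "(R has_real_derivative inverse (- (\<xi>\<^sup>2 / 2 * ((r - 1) / r\<^sup>2)) / g\<^sup>2)) (at x)"
    unfolding R_def r_def g_def using boundary2_ratio_has_deriv[OF \<xi> x] .
  also have "inverse (- (\<xi>\<^sup>2 / 2 * ((r - 1) / r\<^sup>2)) / g\<^sup>2) = - (r\<^sup>2 * g / (x * (r - 1)))"
    unfolding r(2)[symmetric] using r(1) g x by (simp add: field_simps power2_eq_square)
  finally have dR: "(R has_real_derivative - (r\<^sup>2 * g / (x * (r - 1)))) (at x)" .
  have Rx: "R x = r" by (simp add: R_def r_def)
  have "((\<lambda>x. x / R x) has_real_derivative (1 * R x - x * - (r\<^sup>2 * g / (x * (r - 1)))) / (R x * R x)) (at x)"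
    by (rule DERIV_divide[OF DERIV_ident dR]) (use Rx r in simp)
  also have "(1 * R x - x * - (r\<^sup>2 * g / (x * (r - 1)))) / (R x * R x) = 1 / r + g / (r - 1)"
    unfolding Rx using r(1) x by (simp add: field_simps power2_eq_square)
  also have "\<dots> = ln r / (r - 1)"
    using r(1) by (simp add: g_def bj_gap_def field_simps)
  finally have "((\<lambda>x. x / R x) has_real_derivative ln r / (r - 1)) (at x)" .
  moreover have "\<forall>\<^sub>F z in nhds x. z / R z = boundary 2 z \<xi>"
  proof -
    have "\<forall>\<^sub>F z in nhds x. z \<in> {0<..<1}"
      using x by (intro eventually_nhds_in_open) auto
    then show ?thesis
      by eventually_elim (auto simp: R_def)
  qed
  ultimately show ?thesis
    using DERIV_cong_ev[OF refl _ refl, of "\<lambda>x. x / R x" "\<lambda>x. boundary 2 x \<xi>" x "ln r / (r - 1)"] by simp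
qed

text \<open>The defining equation gives \<open>log r \<ge> \<xi>\<^sup>2 / (2x)\<close>: the curve is exponentially small at the origin.\<close>
lemma boundary2_ratio_at_top:
  assumes \<xi>: "0 < \<xi>"
  shows "filterlim (\<lambda>x. x / boundary 2 x \<xi>) at_top (at_right 0)"
proof (rule filterlim_at_top_mono)
  show "filterlim (\<lambda>x. exp (\<xi>\<^sup>2 / 2 / x)) at_top (at_right 0)"
    using \<xi> by real_asymp
  have ev: "\<forall>\<^sub>F x in at_right (0::real). 0 < x \<and> x < 1"
    by (intro eventually_at_rightI[of 0 1]) auto
  then show "\<forall>\<^sub>F x in at_right 0. exp (\<xi>\<^sup>2 / 2 / x) \<le> x / boundary 2 x \<xi>"
  proof eventually_elim
    case (elim x)
    then have "\<xi>\<^sup>2 / 2 \<le> x * ln (x / boundary 2 x \<xi>)"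
      using boundary2_props(3)[of \<xi> x] boundary_props[of 2 x \<xi>] \<xi> by auto
    then have "\<xi>\<^sup>2 / 2 / x \<le> ln (x / boundary 2 x \<xi>)"
      using elim by (simp add: field_simps)
    then show ?case
      using boundary_props[of 2 x \<xi>] elim \<xi> by (subst (asm) ln_ge_iff) auto
  qed
qed


lemma boundary_filterlim_at_right_0:
  assumes "i = 1 \<or> i = 2" "0 < \<xi>"
  shows "filterlim (\<lambda>x. boundary i x \<xi>) (at_right 0) (at_right 0)"
  unfolding filterlim_at
proof
  have "\<forall>\<^sub>F x in at_right (0::real). 0 < x \<and> x < 1"
    by (intro eventually_at_rightI[of 0 1]) auto
  then show "\<forall>\<^sub>F x in at_right 0. boundary i x \<xi> \<in> {0<..} \<and> boundary i x \<xi> \<noteq> 0"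
    by eventually_elim (use boundary_props(1)[of i _ \<xi>] assms in force)
qed (use boundary_tendsto_0 assms in blast)

text \<open>Here \<open>\<rho> = 0\<close>: the sum is dominated by its first term, of order \<open>n^(-k0)\<close>.\<close>
lemma flat_boundary_1:
  assumes \<xi>: "0 < \<xi>"
  shows "flat_boundary (\<lambda>x. boundary 1 x \<xi>) (\<lambda>x. inverse (hc_level_deriv \<xi> (boundary 1 x \<xi>))) 0"
proof
  fix x :: real assume x: "0 < x" "x < 1"
  show b: "0 < boundary 1 x \<xi>" "boundary 1 x \<xi> < x"
    using boundary_props[of 1 x \<xi>] x \<xi> by auto
  show "((\<lambda>x. boundary 1 x \<xi>) has_real_derivative inverse (hc_level_deriv \<xi> (boundary 1 x \<xi>))) (at x)"
    using \<xi> x by (rule boundary1_has_deriv)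
  have "f1 x (boundary 1 x \<xi>) = \<xi>" using boundary_props[of 1 x \<xi>] x \<xi> by (simp add: gof_def)
  then have "hc_level \<xi> (boundary 1 x \<xi>) = x" using b x by (subst (asm) f1_eq_iff) auto
  then show "0 \<le> inverse (hc_level_deriv \<xi> (boundary 1 x \<xi>))"
    using hc_level_deriv_pos[of \<xi> "boundary 1 x \<xi>"] b x \<xi> by (simp add: less_imp_le)
  define y where "y = boundary 1 x \<xi>"
  have "ln (y / x) \<le> y / x - 1" using b x by (intro ln_le_minus_one) (auto simp: y_def)
  then have "x * ln (y / x) \<le> x * (y / x - 1)" using x by (intro mult_left_mono) auto
  also have "x * (y / x - 1) = y - x" using x by (simp add: right_diff_distrib)
  finally have "x * ln (y / x) \<le> y - x" .
  then show "0 \<le> x * ln (x / boundary 1 x \<xi>) - (x - boundary 1 x \<xi>)"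
    using b x unfolding y_def[symmetric] by (simp add: ln_div algebra_simps)
next
  have cont: "continuous_on {0<..<1} (\<lambda>x. boundary 1 x \<xi>)"
    by (intro continuous_at_imp_continuous_on ballI DERIV_isCont[OF boundary1_has_deriv]) (use \<xi> in auto)
  have "continuous_on {0<..<1} (hc_level_deriv \<xi>)"
    unfolding hc_level_deriv_def by (intro continuous_intros) auto
  then have "continuous_on {0<..<1} (\<lambda>x. hc_level_deriv \<xi> (boundary 1 x \<xi>))"
    by (rule continuous_on_compose2[OF _ cont]) (use boundary_props[of 1 _ \<xi>] \<xi> in force)
  then show "continuous_on {0<..<1} (\<lambda>x. inverse (hc_level_deriv \<xi> (boundary 1 x \<xi>)))"
  proof (rule continuous_on_inverse)
    show "\<forall>x\<in>{0<..<1}. hc_level_deriv \<xi> (boundary 1 x \<xi>) \<noteq> 0"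
    proof
      fix x :: real assume x: "x \<in> {0<..<1}"
      then have "hc_level \<xi> (boundary 1 x \<xi>) = x" "0 < boundary 1 x \<xi>" "boundary 1 x \<xi> < 1"
        using boundary_props[of 1 x \<xi>] \<xi> by (auto simp: gof_def f1_eq_iff)
      then show "hc_level_deriv \<xi> (boundary 1 x \<xi>) \<noteq> 0"
        using hc_level_deriv_pos[of \<xi> "boundary 1 x \<xi>"] x \<xi> by auto
    qed
  qed
  have "filterlim (hc_level_deriv \<xi>) at_top (at_right 0)"
    unfolding hc_level_deriv_def using \<xi> by real_asymp
  then have "filterlim (\<lambda>x. hc_level_deriv \<xi> (boundary 1 x \<xi>)) at_top (at_right 0)"
    by (rule filterlim_compose) (use boundary_filterlim_at_right_0 \<xi> in blast)
  then show "((\<lambda>x. inverse (hc_level_deriv \<xi> (boundary 1 x \<xi>))) \<longlongrightarrow> 0) (at_right 0)"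
    by (rule tendsto_inverse_0_at_top)
qed (use boundary1_rate \<xi> in blast)

text \<open>Here \<open>\<rho> = \<xi>\<^sup>2/2\<close>, and \<open>rate_ge\<close> holds with equality because it is the equation that defines the curve.
  The terms differ only by subexponential factors as long as \<open>k = o(n)\<close>, so no single one dominates.\<close>
lemma flat_boundary_2:
  assumes \<xi>: "0 < \<xi>"
  shows "flat_boundary (\<lambda>x. boundary 2 x \<xi>)
    (\<lambda>x. ln (x / boundary 2 x \<xi>) / (x / boundary 2 x \<xi> - 1)) (\<xi>\<^sup>2 / 2)"
proof
  fix x :: real assume x: "0 < x" "x < 1"
  show b: "0 < boundary 2 x \<xi>" "boundary 2 x \<xi> < x"
    using boundary_props[of 2 x \<xi>] x \<xi> by auto
  show "((\<lambda>x. boundary 2 x \<xi>) has_real_derivative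
      ln (x / boundary 2 x \<xi>) / (x / boundary 2 x \<xi> - 1)) (at x)"
    using \<xi> x by (rule boundary2_has_deriv)
  show "0 \<le> ln (x / boundary 2 x \<xi>) / (x / boundary 2 x \<xi> - 1)"
    using boundary2_props(1)[OF \<xi> x] by simp
  show "\<xi>\<^sup>2 / 2 \<le> x * ln (x / boundary 2 x \<xi>) - (x - boundary 2 x \<xi>)"
    using boundary2_props(3)[OF \<xi> x] by simp
next
  have cont: "continuous_on {0<..<1} (\<lambda>x. boundary 2 x \<xi>)"
    by (intro continuous_at_imp_continuous_on ballI DERIV_isCont[OF boundary2_has_deriv]) (use \<xi> in auto)
  show "continuous_on {0<..<1} (\<lambda>x. ln (x / boundary 2 x \<xi>) / (x / boundary 2 x \<xi> - 1))"
    by (intro continuous_intros cont) (use boundary2_props(1)[OF \<xi>] boundary_props[of 2 _ \<xi>] \<xi> in force)+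
  have "((\<lambda>r::real. ln r / (r - 1)) \<longlongrightarrow> 0) at_top" by real_asymp
  then show "((\<lambda>x. ln (x / boundary 2 x \<xi>) / (x / boundary 2 x \<xi> - 1)) \<longlongrightarrow> 0) (at_right 0)"
    by (rule filterlim_compose) (rule boundary2_ratio_at_top[OF \<xi>])
  have "((\<lambda>x. \<xi>\<^sup>2 / 2 + (x - x * ln x) - boundary 2 x \<xi>) \<longlongrightarrow> \<xi>\<^sup>2 / 2 + 0 - 0) (at_right 0)"
  proof (intro tendsto_intros boundary_tendsto_0)
    show "((\<lambda>x::real. x - x * ln x) \<longlongrightarrow> 0) (at_right 0)" by real_asymp
  qed (use \<xi> in auto)
  moreover have "\<forall>\<^sub>F x in at_right 0. \<xi>\<^sup>2 / 2 + (x - x * ln x) - boundary 2 x \<xi> = x * ln (1 / boundary 2 x \<xi>)"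
  proof -
    have "\<forall>\<^sub>F x in at_right (0::real). 0 < x \<and> x < 1"
      by (intro eventually_at_rightI[of 0 1]) auto
    then show ?thesis
    proof eventually_elim
      case (elim x)
      then show ?case
        using boundary2_props(3)[of \<xi> x] boundary_props[of 2 x \<xi>] \<xi>
        by (simp add: ln_div algebra_simps)
    qed
  qed
  ultimately show "((\<lambda>x. x * ln (1 / boundary 2 x \<xi>)) \<longlongrightarrow> \<xi>\<^sup>2 / 2) (at_right 0)"
    using tendsto_cong by fastforce
qed

section \<open>Independent uniform p-values\<close>

theorem theorem6p1:
  fixes M :: "nat \<Rightarrow> 'a measure"
    and p :: "nat \<Rightarrow> nat \<Rightarrow> 'a \<Rightarrow> real"
    and \<xi> \<beta> :: real
    and i k0 :: nat
    and rnd :: "real \<Rightarrow> int"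
    and C :: "real \<Rightarrow> real"
  assumes prob: "\<And>n. prob_space (M n)"
    and indep: "\<And>n. prob_space.indep_vars (M n) (\<lambda>_. borel) (p n) {..<n}"
    and unif: "\<And>n j. j < n \<Longrightarrow> distr (M n) borel (p n j) = uniform_measure lborel {0..1}"
    and "i = 1 \<or> i = 2"
    and "0 < \<xi>"
    and C: "C = (\<lambda>x. boundary i x \<xi>)"
    and "0 < \<beta>" "\<beta> < 1"
    and "1 \<le> k0"
    and rnd: "rnd = floor \<or> rnd = ceiling"
  shows "(\<lambda>n. measure (M n)
            (\<Union>k\<in>{k0..nat (rnd (\<beta> * real n))}.
               {\<omega> \<in> space (M n). order_stat n (\<lambda>j. p n j \<omega>) k \<le> C (real k / real n)}))
         \<sim>[at_top]
         (\<lambda>n. \<Sum>k = k0..nat (rnd (\<beta> * real n)).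
            (1 - (real n - real k + 1) * deriv C (real k / real n)
                 / (real n * (1 - C (real k / real n))))
            * binom_prob n k (C (real k / real n)))"
proof -
  define K where "K n = nat (rnd (\<beta> * real n))" for n
  have K: "\<beta> * real n - 1 \<le> real (K n)" "real (K n) \<le> \<beta> * real n + 1" for n
  proof -
    have "0 \<le> \<beta> * real n" using \<open>0 < \<beta>\<close> by simp
    then have "0 \<le> rnd (\<beta> * real n)" using rnd ceiling_mono[of 0 "\<beta> * real n"] by auto
    then have "real (K n) = of_int (rnd (\<beta> * real n))" by (simp add: K_def)
    moreover have "\<beta> * real n - 1 \<le> of_int (rnd (\<beta> * real n)) \<and> of_int (rnd (\<beta> * real n)) \<le> \<beta> * real n + 1"
      using rnd
    proof
      assume "rnd = floor"
      then show ?thesis using floor_correct[of "\<beta> * real n"] by (simp only:) linarith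
    next
      assume "rnd = ceiling"
      then show ?thesis using ceiling_correct[of "\<beta> * real n"] by (simp only:) linarith
    qed
    ultimately show "\<beta> * real n - 1 \<le> real (K n)" "real (K n) \<le> \<beta> * real n + 1" by simp_all
  qed
  have sample: "uniform_sample (M n) n (p n)" for n
    unfolding uniform_sample_def uniform_sample_axioms_def using prob indep unif by blast
  obtain D \<rho> where flat: "flat_boundary C D \<rho>"
    using flat_boundary_1[OF \<open>0 < \<xi>\<close>] flat_boundary_2[OF \<open>0 < \<xi>\<close>] \<open>i = 1 \<or> i = 2\<close> unfolding C by blast
  interpret flat_boundary C D \<rho> by (rule flat)
  have Kn: "\<forall>\<^sub>F n in sequentially. K n < n"
  proof -
    have "\<forall>\<^sub>F n in sequentially. \<beta> * real n + 1 < real n"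
      using \<open>\<beta> < 1\<close> by real_asymp
    then show ?thesis
      by eventually_elim (use K(2) in \<open>metis le_less_trans of_nat_less_iff\<close>)
  qed
  let ?hit = "\<lambda>n. measure (M n) (\<Union>k\<in>{k0..K n}. {\<omega> \<in> space (M n).
             k \<le> card (uniform_sample.below n (p n) (C (real k / real n)) \<omega>)})"
  let ?P = "\<lambda>n. measure (M n) (\<Union>k\<in>{k0..K n}.
               {\<omega> \<in> space (M n). order_stat n (\<lambda>j. p n j \<omega>) k \<le> C (real k / real n)})"
  let ?T = "\<lambda>n. \<Sum>k = k0..K n. (1 - (real n - real k + 1) * D (real k / real n)
             / (real n * (1 - C (real k / real n)))) * binom_prob n k (C (real k / real n))"
  let ?T' = "\<lambda>n. \<Sum>k = k0..K n. (1 - (real n - real k + 1) * deriv C (real k / real n)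
             / (real n * (1 - C (real k / real n)))) * binom_prob n k (C (real k / real n))"
  have P: "\<forall>\<^sub>F n in sequentially. ?hit n = ?P n"
    using Kn
  proof eventually_elim
    case (elim n)
    have "order_stat n (\<lambda>j. p n j \<omega>) k \<le> c \<longleftrightarrow> k \<le> card (uniform_sample.below n (p n) c \<omega>)"
      if "k \<in> {k0..K n}" for k \<omega> c
      using that elim \<open>1 \<le> k0\<close> order_stat_le_iff[of k n "\<lambda>j. p n j \<omega>" c]
      by (simp add: uniform_sample.below_def[OF sample])
    then show ?case by simp
  qed
  have T: "\<forall>\<^sub>F n in sequentially. ?T n = ?T' n"
    using Kn
  proof eventually_elim
    case (elim n)
    have "D (real k / real n) = deriv C (real k / real n)" if "k \<in> {k0..K n}" for k
      using C_has_deriv[OF frac_range[of k n]] that elim \<open>1 \<le> k0\<close> by (auto dest: DERIV_imp_deriv)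
    then show ?case by simp
  qed
  have "?hit \<sim>[sequentially] ?T"
    by (rule asymp_equiv_trans[OF hitting_prob_asymp[OF \<open>1 \<le> k0\<close> \<open>0 < \<beta>\<close> \<open>\<beta> < 1\<close> K sample]
        asymp_equiv_symI[OF correction_negligible[OF \<open>1 \<le> k0\<close> \<open>0 < \<beta>\<close> \<open>\<beta> < 1\<close> K]]])
  then have "?P \<sim>[sequentially] ?T'"
    using asymp_equiv_cong[OF P T] by (rule iffD1[rotated])
  then show ?thesis unfolding K_def .
qed

end
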